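(* Let $N\ge1$ be an integer, $0<c\le1/2^{2N-1}$ and $b>0$ a real number. The convergence $(\tau_b^{\varepsilon+},X_b^{\varepsilon+})\longrightarrow(\tau_b^+,X_b^+)$ as $\varepsilon\to0^+$ holds, i.e. for any $\lambda>0$ and $\mu\in\mathbb{R}$, $$\lim_{\varepsilon\to0^+}\mathbb{E}\Big(\mathrm{e}^{-\lambda\tau_b^{\varepsilon+}+\mathrm{i}\mu X_b^{\varepsilon+}}1_{\{\tau_b^{\varepsilon+}<+\infty\}}\Big)=\mathbb{E}\Big(\mathrm{e}^{-\lambda\tau_b^++\mathrm{i}\mu X_b^+}1_{\{\tau_b^+<+\infty\}}\Big),$$ where, for any $\lambda>0$ and any $\mu\in\mathbb{R}$, $$\mathbb{E}\Big(\mathrm{e}^{-\lambda\tau_b^++\mathrm{i}\mu X_b^+}1_{\{\tau_b^+<+\infty\}}\Big)=\mathrm{e}^{\mathrm{i}\mu b}\sum_{k=1}^N\ \prod_{\substack{1\le j\le N\\ j\ne k}}\frac{\varphi_j}{\varphi_j-\varphi_k}\ \prod_{\substack{1\le j\le N\\ j\ne k}}\bigg(1-\frac{\mathrm{i}\,\overline{\varphi_j}\,\mu}{\sqrt[2N]{\lambda/c}}\bigg)\,\mathrm{e}^{-\varphi_k\sqrt[2N]{\lambda/c}\,b}.$$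
   Context: $\varphi_j=-\mathrm{i}\,\mathrm{e}^{\mathrm{i}\frac{2j-1}{2N}\pi}$, $1\le j\le N$ (the $(2N)$th roots of $(-1)^{N-1}$ with positive real part). Pseudo-random walk: put $p_k=\delta_{k0}+(-1)^{k-1}c\binom{2N}{k+N}$ for $k\in\{-N,\dots,N\}$ (real, possibly negative, summing to $1$), $p_k=0$ otherwise. The $U_n$ are i.i.d. pseudo-random variables, $\mathbb{P}\{U_1=k_1,\dots,U_n=k_n\}=p_{k_1}\cdots p_{k_n}$; $S_0=0$, $S_n=U_1+\dots+U_n$. For an integer $\beta\ge1$, $\sigma_\beta^+=\min\{n\ge1:S_n\ge\beta\}$, $S_\beta^+=S_{\sigma_\beta^+}\in\{\beta,\dots,\beta+N-1\}$, $\mathbb{P}\{\sigma_\beta^+=k,S_\beta^+=\ell\}=\mathbb{P}\{S_1<\beta,\dots,S_{k-1}<\beta,S_k=\ell\}$, and $H_{\beta,\ell}^+(z)=\sum_{k\ge1}\mathbb{P}\{\sigma_\beta^+=k,S_\beta^+=\ell\}z^k$, which converges absolutely for $|z|<1/\sum_k|p_k|$ and for other $z\in(0,1)$ is understood as the real-analytic continuation to $(0,1)$. Normalized walk: $X_t^\varepsilon=\varepsilon S_{\lfloor t/\varepsilon^{2N}\rfloor}$; $\tau_b^{\varepsilon+}=\inf\{t\ge0:X_t^\varepsilon\ge b\}$, $X_b^{\varepsilon+}=X^\varepsilon_{\tau_b^{\varepsilon+}}$. With $b_\varepsilon=\lceil b/\varepsilon\rceil$, $\tau_b^{\varepsilon+}=\varepsilon^{2N}\sigma_{b_\varepsilon}^+$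 and $X_b^{\varepsilon+}=\varepsilon S_{b_\varepsilon}^+$, so that $$\mathbb{E}\Big(\mathrm{e}^{-\lambda\tau_b^{\varepsilon+}+\mathrm{i}\mu X_b^{\varepsilon+}}1_{\{\tau_b^{\varepsilon+}<+\infty\}}\Big)=\sum_{\ell=b_\varepsilon}^{b_\varepsilon+N-1}\mathrm{e}^{\mathrm{i}\mu\varepsilon\ell}H_{b_\varepsilon,\ell}^+\big(\mathrm{e}^{-\lambda\varepsilon^{2N}}\big).$$ Limit: $(X_t)_{t\ge0}$ is the pseudo-Brownian motion (pseudo-process with independent stationary increments and $\mathbb{E}(\mathrm{e}^{\mathrm{i}uX_t})=\mathrm{e}^{-ctu^{2N}}$), $\tau_b^+=\inf\{t\ge0:X_t\ge b\}$, $X_b^+=X_{\tau_b^+}$; the pseudo-distribution of $(\tau_b^+,X_b^+)$ is understood through its Laplace--Fourier transform, the limit as $\varepsilon\to0^+$ of that of $(\tau_b^{\varepsilon+},X_b^{\varepsilon+})$. The content is the existence and explicit value of the limit. *)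

theory Defs
  imports "HOL-Complex_Analysis.Complex_Analysis"
begin

definition phi :: "nat \<Rightarrow> nat \<Rightarrow> complex" where
  "phi N j = - \<i> * exp (\<i> * complex_of_real ((2 * real j - 1) / (2 * real N) * pi))"

definition step_weight :: "nat \<Rightarrow> real \<Rightarrow> int \<Rightarrow> real" where
  "step_weight N c k =
     (if k \<in> {- int N..int N}
      then (if k = 0 then 1 else 0) + (- 1) powi (k - 1) * c * real ((2 * N) choose nat (k + int N))
      else 0)"

definition total_weight :: "nat \<Rightarrow> real \<Rightarrow> real" where
  "total_weight N c = (\<Sum>k\<in>{- int N..int N}. \<bar>step_weight N c k\<bar>)"

definition steps :: "nat \<Rightarrow> nat \<Rightarrow> (nat \<Rightarrow> int) set" where
  "steps N n = {1..n} \<rightarrow>\<^sub>E {- int N..int N}"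

definition walk :: "(nat \<Rightarrow> int) \<Rightarrow> nat \<Rightarrow> int" where
  "walk u n = (\<Sum>j=1..n. u j)"

text \<open>There is no signed measure on infinite step sequences here: only events determined by the
  first \<open>n\<close> steps carry a pseudo-probability, and \<open>A\<close> has to be such an event.\<close>

definition pprob :: "nat \<Rightarrow> real \<Rightarrow> nat \<Rightarrow> (nat \<Rightarrow> int) set \<Rightarrow> real" where
  "pprob N c n A = (\<Sum>u\<in>steps N n \<inter> A. \<Prod>j=1..n. step_weight N c (u j))"

definition passage_event :: "int \<Rightarrow> nat \<Rightarrow> int \<Rightarrow> (nat \<Rightarrow> int) set" where
  "passage_event \<beta> k l = {u. (\<forall>j\<in>{1..<k}. walk u j < \<beta>) \<and> walk u k = l}"

definition passage_prob :: "nat \<Rightarrow> real \<Rightarrow> int \<Rightarrow> nat \<Rightarrow> int \<Rightarrow> real" where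
  "passage_prob N c \<beta> k l = pprob N c k (passage_event \<beta> k l)"

definition H_series :: "nat \<Rightarrow> real \<Rightarrow> int \<Rightarrow> int \<Rightarrow> real \<Rightarrow> real" where
  "H_series N c \<beta> l z = (\<Sum>k. passage_prob N c \<beta> (Suc k) l * z ^ Suc k)"

definition real_analytic_on :: "(real \<Rightarrow> real) \<Rightarrow> real set \<Rightarrow> bool"
    (infixl \<open>real'_analytic'_on\<close> 50) where
  "f real_analytic_on S \<longleftrightarrow> (\<forall>x\<in>S. \<exists>F. (\<lambda>h. f (x + h)) has_fps_expansion F)"

definition H_continuation :: "nat \<Rightarrow> real \<Rightarrow> int \<Rightarrow> int \<Rightarrow> (real \<Rightarrow> real) \<Rightarrow> bool" where
  "H_continuation N c \<beta> l h \<longleftrightarrow>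
     h real_analytic_on {0<..<1} \<and>
     (\<forall>z\<in>{0<..<1}. z < 1 / total_weight N c \<longrightarrow> h z = H_series N c \<beta> l z)"

text \<open>Only the values on \<open>{0<..<1}\<close> are meaningful; there the continuation is unique, see
  \<open>H_continuation_unique\<close> below.\<close>

definition H_plus :: "nat \<Rightarrow> real \<Rightarrow> int \<Rightarrow> int \<Rightarrow> real \<Rightarrow> real" where
  "H_plus N c \<beta> l = (SOME h. H_continuation N c \<beta> l h)"

definition scaled_walk :: "nat \<Rightarrow> real \<Rightarrow> (nat \<Rightarrow> int) \<Rightarrow> real \<Rightarrow> real" where
  "scaled_walk N \<epsilon> u t = \<epsilon> * real_of_int (walk u (nat \<lfloor>t / \<epsilon> ^ (2 * N)\<rfloor>))"

definition scaled_time :: "nat \<Rightarrow> real \<Rightarrow> real \<Rightarrow> (nat \<Rightarrow> int) \<Rightarrow> real" where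
  "scaled_time N b \<epsilon> u = Inf {t. t \<ge> 0 \<and> scaled_walk N \<epsilon> u t \<ge> b}"

definition scaled_place :: "nat \<Rightarrow> real \<Rightarrow> real \<Rightarrow> (nat \<Rightarrow> int) \<Rightarrow> real" where
  "scaled_place N b \<epsilon> u = scaled_walk N \<epsilon> u (scaled_time N b \<epsilon> u)"

definition level :: "real \<Rightarrow> real \<Rightarrow> int" where
  "level b \<epsilon> = \<lceil>b / \<epsilon>\<rceil>"

text \<open>The Laplace--Fourier transform of the scaled first passage time and place. When
  \<open>exp (- lam * \<epsilon> ^ (2 * N)) < 1 / total_weight N c\<close> the functions \<open>H_plus\<close> are power series and
  this is a sum over paths, see \<open>scaled_transform_series\<close> below; for the other \<open>lam\<close> it is
  understood by analytic continuation of these power series.\<close>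

definition scaled_transform ::
    "nat \<Rightarrow> real \<Rightarrow> real \<Rightarrow> real \<Rightarrow> real \<Rightarrow> real \<Rightarrow> complex" where
  "scaled_transform N c b \<epsilon> lam \<mu> =
     (\<Sum>l\<in>{level b \<epsilon>..level b \<epsilon> + int N - 1}.
        exp (\<i> * complex_of_real (\<mu> * \<epsilon> * real_of_int l)) *
        complex_of_real (H_plus N c (level b \<epsilon>) l (exp (- lam * \<epsilon> ^ (2 * N)))))"

text \<open>Pseudo-Brownian motion has no path measure: the pseudo-law of its first passage time and place
  is by definition given by the limiting transform.\<close>

definition limit_transform :: "nat \<Rightarrow> real \<Rightarrow> real \<Rightarrow> real \<Rightarrow> real \<Rightarrow> complex" where
  "limit_transform N c b lam \<mu> = Lim (at_right 0) (\<lambda>\<epsilon>. scaled_transform N c b \<epsilon> lam \<mu>)"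


lemma real_analytic_on_zero_dichotomy:
  fixes F :: "real fps"
  assumes "g has_fps_expansion F"
  shows "(\<forall>\<^sub>F y in nhds 0. g y = 0) \<or> (\<forall>\<^sub>F y in at 0. g y \<noteq> 0)"
proof (cases "F = 0")
  case True
  then show ?thesis
    using assms by (auto simp: has_fps_expansion_def elim: eventually_mono)
next
  case False
  from assms have R: "fps_conv_radius F > 0" and ev: "\<forall>\<^sub>F z in nhds 0. eval_fps F z = g z"
    by (auto simp: has_fps_expansion_def)
  have cont: "isCont g 0"
    using has_fps_expansion_imp_continuous[OF assms] by simp
  have g0: "g 0 = fps_nth F 0"
    using eventually_nhds_x_imp_x[OF ev] by (simp add: eval_fps_at_0)
  show ?thesis
  proof (cases "g 0 = 0")
    case False
    have "\<forall>\<^sub>F y in at 0. g y \<noteq> 0"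
      using cont False by (metis isCont_def tendsto_imp_eventually_ne)
    then show ?thesis by blast
  next
    case True
    from \<open>F \<noteq> 0\<close> obtain m where m: "fps_nth F m \<noteq> 0"
      by (auto simp: fps_eq_iff)
    with True g0 have "m > 0" by (cases m) auto
    obtain r where r: "r > 0" "ereal r < fps_conv_radius F"
      using R ereal_dense2[of 0 "fps_conv_radius F"] by auto
    have sm: "(\<lambda>n. fps_nth F n * (x - 0) ^ n) sums eval_fps F x" if "norm (x - 0) < r" for x
    proof -
      have "ereal (norm x) < fps_conv_radius F"
        using that r by (metis diff_zero ereal_less_le less_imp_le)
      then show ?thesis using sums_eval_fps[of x F] by (simp add: sums_eval_fps)
    qed
    have "eval_fps F 0 = 0" using True g0 by (simp add: eval_fps_at_0)
    then obtain s where s: "s > 0" "\<And>z. z \<in> cball 0 s - {0} \<Longrightarrow> eval_fps F z \<noteq> 0"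
      using powser_0_nonzero[OF r(1) sm _ m \<open>m > 0\<close>] by blast
    have "\<forall>\<^sub>F z in at 0. eval_fps F z \<noteq> 0"
      unfolding eventually_at using s by (intro exI[of _ s]) (auto simp: dist_norm)
    moreover have "\<forall>\<^sub>F z in at 0. eval_fps F z = g z"
      using ev by (simp add: eventually_nhds_conv_at)
    ultimately have "\<forall>\<^sub>F y in at 0. g y \<noteq> 0"
      by eventually_elim simp
    then show ?thesis by blast
  qed
qed

lemma real_analytic_on_unique:
  assumes f: "f real_analytic_on {a<..<b}" and g: "g real_analytic_on {a<..<b}"
    and d: "a < d" "d \<le> b" and eq: "\<And>z. a < z \<Longrightarrow> z < d \<Longrightarrow> f z = g z"
    and z: "z \<in> {a<..<b}"
  shows "f z = g z"
proof -
  define A where "A = {x \<in> {a<..<b}. \<forall>\<^sub>F y in nhds x. f y = g y}"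
  define B where "B = {x \<in> {a<..<b}. \<forall>\<^sub>F y in at x. f y \<noteq> g y}"
  have AB: "x \<in> A \<or> x \<in> B" if x: "x \<in> {a<..<b}" for x
  proof -
    obtain F G where "(\<lambda>h. f (x + h)) has_fps_expansion F" "(\<lambda>h. g (x + h)) has_fps_expansion G"
      using f g x unfolding real_analytic_on_def by blast
    then have "(\<lambda>h. f (x + h) - g (x + h)) has_fps_expansion F - G"
      by (rule has_fps_expansion_diff)
    from real_analytic_on_zero_dichotomy[OF this]
    have "(\<forall>\<^sub>F y in nhds x. f y - g y = 0) \<or> (\<forall>\<^sub>F y in at x. f y - g y \<noteq> 0)"
      by (simp add: nhds_to_0[of x] at_to_0'[of x] eventually_filtermap add.commute)
    then show ?thesis using x by (auto simp: A_def B_def)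
  qed
  have openA: "open A"
    unfolding A_def
  proof (subst open_subopen, clarsimp)
    fix x assume x: "a < x" "x < b" "\<forall>\<^sub>F y in nhds x. f y = g y"
    then obtain S where S: "open S" "x \<in> S" "\<And>y. y \<in> S \<Longrightarrow> f y = g y"
      by (auto simp: eventually_nhds)
    have "\<forall>\<^sub>F y in nhds w. f y = g y" if "w \<in> S" for w
      using S that by (auto simp: eventually_nhds)
    then show "\<exists>T. open T \<and> x \<in> T \<and>
        T \<subseteq> {x. a < x \<and> x < b \<and> (\<forall>\<^sub>F y in nhds x. f y = g y)}"
      using S x by (intro exI[of _ "S \<inter> {a<..<b}"]) auto
  qed
  have openB: "open B"
    unfolding B_def
  proof (subst open_subopen, clarsimp)
    fix x assume x: "a < x" "x < b" "\<forall>\<^sub>F y in at x. f y \<noteq> g y"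
    then obtain S where S: "open S" "x \<in> S" "\<And>y. y \<in> S \<Longrightarrow> y \<noteq> x \<Longrightarrow> f y \<noteq> g y"
      by (auto simp: eventually_at_topological)
    have "\<forall>\<^sub>F y in at w. f y \<noteq> g y" if "w \<in> S" for w
    proof (cases "w = x")
      case False
      have "\<forall>\<^sub>F y in nhds w. y \<in> S - {x}"
        using S that False by (intro eventually_nhds_in_open) auto
      then have "\<forall>\<^sub>F y in nhds w. f y \<noteq> g y"
        by eventually_elim (use S in auto)
      then show ?thesis by (simp add: eventually_nhds_conv_at)
    qed (use x in simp)
    then show "\<exists>T. open T \<and> x \<in> T \<and>
        T \<subseteq> {x. a < x \<and> x < b \<and> (\<forall>\<^sub>F y in at x. f y \<noteq> g y)}"
      using S x by (intro exI[of _ "S \<inter> {a<..<b}"]) auto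
  qed
  have disj: "A \<inter> B = {}"
  proof -
    have False if "\<forall>\<^sub>F y in nhds x. f y = g y" "\<forall>\<^sub>F y in at x. f y \<noteq> g y" for x
    proof -
      have "\<forall>\<^sub>F y in at x. f y = g y" using that(1) by (simp add: eventually_nhds_conv_at)
      with that(2) have "\<forall>\<^sub>F y in at x. False" by eventually_elim simp
      then show False by simp
    qed
    then show ?thesis by (auto simp: A_def B_def)
  qed
  have "(a + d) / 2 \<in> A"
  proof -
    have "\<forall>\<^sub>F y in nhds ((a + d) / 2). y \<in> {a<..<d}"
      using d by (intro eventually_nhds_in_open) (auto simp: field_simps)
    then have "\<forall>\<^sub>F y in nhds ((a + d) / 2). f y = g y"
      by eventually_elim (use eq in auto)
    then show ?thesis using d by (auto simp: A_def field_simps)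
  qed
  moreover have "A \<subseteq> {a<..<b}" by (auto simp: A_def)
  ultimately have "A \<inter> {a<..<b} \<noteq> {}" by blast
  moreover have "A \<inter> {a<..<b} = {} \<or> B \<inter> {a<..<b} = {}"
  proof (rule connectedD)
    show "{a<..<b} \<subseteq> A \<union> B" using AB by blast
  qed (use openA openB disj in auto)
  ultimately have "B \<inter> {a<..<b} = {}" by blast
  with AB z have "z \<in> A" by blast
  then show ?thesis using eventually_nhds_x_imp_x by (auto simp: A_def)
qed

lemma total_weight_pos:
  assumes "N \<ge> 1" "c > 0"
  shows "total_weight N c > 0"
proof -
  have "step_weight N c 1 = c * real ((2 * N) choose nat (1 + int N))"
    using assms by (simp add: step_weight_def)
  moreover have "nat (1 + int N) \<le> 2 * N" using assms by auto
  ultimately have "\<bar>step_weight N c 1\<bar> > 0" using assms by simp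
  moreover have "\<bar>step_weight N c 1\<bar> \<le> total_weight N c"
    unfolding total_weight_def using assms by (intro member_le_sum) auto
  ultimately show ?thesis by linarith
qed

lemma H_continuation_unique:
  assumes "N \<ge> 1" "c > 0" "H_continuation N c \<beta> l f" "H_continuation N c \<beta> l g" "z \<in> {0<..<1}"
  shows "f z = g z"
proof (rule real_analytic_on_unique[where f = f and g = g and a = 0 and b = 1
      and d = "min 1 (1 / total_weight N c)"])
  show "f real_analytic_on {0<..<1}" "g real_analytic_on {0<..<1}"
    using assms(3,4) by (simp_all add: H_continuation_def)
  show "0 < min 1 (1 / total_weight N c)" "min 1 (1 / total_weight N c) \<le> 1"
    using total_weight_pos[OF assms(1,2)] by simp_all
  show "f x = g x" if "0 < x" "x < min 1 (1 / total_weight N c)" for x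
    using assms(3,4) that by (simp add: H_continuation_def)
qed (rule assms(5))

lemma passage_prob_bound: "\<bar>passage_prob N c \<beta> k l\<bar> \<le> total_weight N c ^ k"
proof -
  have fin: "finite (steps N k)" by (auto simp: steps_def intro!: finite_PiE)
  have "\<bar>passage_prob N c \<beta> k l\<bar>
      \<le> (\<Sum>u\<in>steps N k \<inter> passage_event \<beta> k l. \<Prod>j=1..k. \<bar>step_weight N c (u j)\<bar>)"
    unfolding passage_prob_def pprob_def using sum_abs by (simp add: abs_prod[symmetric])
  also have "\<dots> \<le> (\<Sum>u\<in>steps N k. \<Prod>j=1..k. \<bar>step_weight N c (u j)\<bar>)"
    using fin by (intro sum_mono2) (auto intro!: prod_nonneg)
  also have "\<dots> = (\<Prod>j=1..k. total_weight N c)"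
    unfolding steps_def total_weight_def by (subst prod_sum_PiE) auto
  finally show ?thesis by simp
qed

lemma H_series_abs_summable:
  assumes "N \<ge> 1" "c > 0" "\<bar>z\<bar> < 1 / total_weight N c"
  shows "summable (\<lambda>k. \<bar>passage_prob N c \<beta> (Suc k) l * z ^ Suc k\<bar>)"
proof -
  let ?M = "total_weight N c"
  have M: "?M > 0" using total_weight_pos assms by blast
  have lt: "?M * \<bar>z\<bar> < 1" using assms(3) M by (simp add: field_simps)
  have "summable (\<lambda>k. (?M * \<bar>z\<bar>) ^ Suc k)"
    using lt M by (subst summable_Suc_iff) (auto intro!: summable_geometric simp: abs_mult)
  then show ?thesis
  proof (rule summable_comparison_test'[where N = 0])
    fix k :: nat
    have "\<bar>passage_prob N c \<beta> (Suc k) l\<bar> * \<bar>z\<bar> ^ Suc k \<le> ?M ^ Suc k * \<bar>z\<bar> ^ Suc k"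
      by (intro mult_right_mono passage_prob_bound) auto
    then show "norm \<bar>passage_prob N c \<beta> (Suc k) l * z ^ Suc k\<bar> \<le> (?M * \<bar>z\<bar>) ^ Suc k"
      by (simp only: abs_mult power_abs power_mult_distrib real_norm_def abs_abs)
  qed
qed

definition first_passage :: "int \<Rightarrow> nat \<Rightarrow> (nat \<Rightarrow> int) set" where
  "first_passage \<beta> k = {u. k \<ge> 1 \<and> walk u k \<ge> \<beta> \<and> (\<forall>j\<in>{1..<k}. walk u j < \<beta>)}"

lemma level_le_iff:
  assumes "\<epsilon> > 0"
  shows "b \<le> \<epsilon> * real_of_int m \<longleftrightarrow> level b \<epsilon> \<le> m"
  using assms by (simp add: level_def ceiling_le_iff field_simps)

lemma level_pos: "b > 0 \<Longrightarrow> \<epsilon> > 0 \<Longrightarrow> level b \<epsilon> \<ge> 1"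
  by (simp add: level_def)

lemma scaled_first_passage:
  assumes "b > 0" "\<epsilon> > 0" "u \<in> first_passage (level b \<epsilon>) k"
  shows "scaled_time N b \<epsilon> u = \<epsilon> ^ (2 * N) * real k"
    and "scaled_place N b \<epsilon> u = \<epsilon> * real_of_int (walk u k)"
proof -
  let ?e = "\<epsilon> ^ (2 * N)"
  have e: "?e > 0" using assms by simp
  have k: "k \<ge> 1" "walk u k \<ge> level b \<epsilon>" "\<And>j. j < k \<Longrightarrow> walk u j < level b \<epsilon>"
  proof -
    show "walk u j < level b \<epsilon>" if "j < k" for j
      using that assms level_pos[OF assms(1,2)]
      by (cases "j = 0") (auto simp: first_passage_def walk_def)
  qed (use assms in \<open>auto simp: first_passage_def\<close>)
  have at_k: "scaled_walk N \<epsilon> u (?e * real k) = \<epsilon> * real_of_int (walk u k)"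
    using e by (simp add: scaled_walk_def)
  have "Inf {t. t \<ge> 0 \<and> scaled_walk N \<epsilon> u t \<ge> b} = ?e * real k"
  proof (rule cInf_eq_minimum)
    show "?e * real k \<in> {t. t \<ge> 0 \<and> scaled_walk N \<epsilon> u t \<ge> b}"
      using e k at_k level_le_iff[OF assms(2)] by simp
    fix t assume "t \<in> {t. t \<ge> 0 \<and> scaled_walk N \<epsilon> u t \<ge> b}"
    then have t: "t \<ge> 0" "level b \<epsilon> \<le> walk u (nat \<lfloor>t / ?e\<rfloor>)"
      by (auto simp: scaled_walk_def level_le_iff[OF assms(2)])
    then have "k \<le> nat \<lfloor>t / ?e\<rfloor>" using k(3) by (meson leD leI)
    then have "real k \<le> t / ?e" using t e k(1) by (simp add: le_nat_iff le_floor_iff)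
    then show "?e * real k \<le> t" using e by (simp add: field_simps)
  qed
  then show 1: "scaled_time N b \<epsilon> u = ?e * real k" by (simp add: scaled_time_def)
  show "scaled_place N b \<epsilon> u = \<epsilon> * real_of_int (walk u k)"
    unfolding scaled_place_def 1 by (rule at_k)
qed

lemma scaled_transform_series:
  assumes "N \<ge> 1" "c > 0" "b > 0" "\<epsilon> > 0"
    and conv: "exp (- lam * \<epsilon> ^ (2 * N)) < 1 / total_weight N c"
  shows "(\<lambda>k. \<Sum>u\<in>steps N (Suc k) \<inter> first_passage (level b \<epsilon>) (Suc k).
             complex_of_real (\<Prod>j=1..Suc k. step_weight N c (u j)) *
             exp (complex_of_real (- lam * scaled_time N b \<epsilon> u) +
                  \<i> * complex_of_real (\<mu> * scaled_place N b \<epsilon> u)))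
         sums (\<Sum>l\<in>{level b \<epsilon>..level b \<epsilon> + int N - 1}.
             exp (\<i> * complex_of_real (\<mu> * \<epsilon> * real_of_int l)) *
             complex_of_real (H_series N c (level b \<epsilon>) l (exp (- lam * \<epsilon> ^ (2 * N)))))"
proof -
  let ?b = "level b \<epsilon>" and ?z = "exp (- lam * \<epsilon> ^ (2 * N))"
  let ?L = "{?b..?b + int N - 1}"
  have range: "walk u (Suc k) \<in> ?L"
    if "u \<in> steps N (Suc k) \<inter> first_passage ?b (Suc k)" for u k
  proof -
    have "walk u (Suc k) = walk u k + u (Suc k)" by (simp add: walk_def)
    moreover have "u (Suc k) \<le> int N" using that by (auto simp: steps_def PiE_iff)
    moreover have "walk u k < ?b"
      using that level_pos[OF assms(3,4)] by (cases "k = 0") (auto simp: first_passage_def walk_def)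
    ultimately show ?thesis using that by (auto simp: first_passage_def)
  qed
  have fin: "finite (steps N n)" for n by (auto simp: steps_def intro!: finite_PiE)
  have "(\<Sum>u\<in>steps N (Suc k) \<inter> first_passage ?b (Suc k).
             complex_of_real (\<Prod>j=1..Suc k. step_weight N c (u j)) *
             exp (complex_of_real (- lam * scaled_time N b \<epsilon> u) +
                  \<i> * complex_of_real (\<mu> * scaled_place N b \<epsilon> u)))
       = (\<Sum>l\<in>?L. exp (\<i> * complex_of_real (\<mu> * \<epsilon> * real_of_int l)) *
             complex_of_real (passage_prob N c ?b (Suc k) l * ?z ^ Suc k))" (is "?lhs = _") for k
  proof -
    let ?w = "\<lambda>u. \<Prod>j=1..Suc k. step_weight N c (u j)"
    have "?lhs = (\<Sum>u\<in>steps N (Suc k) \<inter> first_passage ?b (Suc k).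
        exp (\<i> * complex_of_real (\<mu> * \<epsilon> * real_of_int (walk u (Suc k)))) *
        complex_of_real (?w u * ?z ^ Suc k))"
    proof (rule sum.cong[OF refl], goal_cases)
      case (1 u)
      then have u: "u \<in> first_passage ?b (Suc k)" by blast
      have z: "complex_of_real (?z ^ Suc k) = exp (complex_of_real (- lam * (\<epsilon> ^ (2 * N) * real (Suc k))))"
        by (subst exp_of_nat_mult[symmetric]) (simp add: exp_of_real[symmetric] algebra_simps)
      show ?case
        unfolding scaled_first_passage[OF assms(3,4) u] of_real_mult[of "?w u"] z exp_add
        by (simp add: mult_ac)
    qed
    also have "\<dots> = (\<Sum>l\<in>?L. \<Sum>u\<in>{u \<in> steps N (Suc k) \<inter> first_passage ?b (Suc k). walk u (Suc k) = l}.
        exp (\<i> * complex_of_real (\<mu> * \<epsilon> * real_of_int (walk u (Suc k)))) *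
        complex_of_real (?w u * ?z ^ Suc k))"
      using range fin by (intro sum.group[symmetric]) auto
    also have "\<dots> = (\<Sum>l\<in>?L. exp (\<i> * complex_of_real (\<mu> * \<epsilon> * real_of_int l)) *
             complex_of_real (passage_prob N c ?b (Suc k) l * ?z ^ Suc k))"
    proof (rule sum.cong[OF refl], goal_cases)
      case (1 l)
      then have "{u \<in> steps N (Suc k) \<inter> first_passage ?b (Suc k). walk u (Suc k) = l}
          = steps N (Suc k) \<inter> passage_event ?b (Suc k) l"
        by (auto simp: first_passage_def passage_event_def)
      then show ?case
        unfolding passage_prob_def pprob_def of_real_mult of_real_sum sum_distrib_left sum_distrib_right
        by (intro sum.cong) (auto simp: passage_event_def)
    qed
    finally show ?thesis .
  qed
  moreover have "(\<lambda>k. \<Sum>l\<in>?L. exp (\<i> * complex_of_real (\<mu> * \<epsilon> * real_of_int l)) *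
             complex_of_real (passage_prob N c ?b (Suc k) l * ?z ^ Suc k))
       sums (\<Sum>l\<in>?L. exp (\<i> * complex_of_real (\<mu> * \<epsilon> * real_of_int l)) *
             complex_of_real (H_series N c ?b l ?z))"
  proof (intro sums_sum sums_mult sums_of_real)
    fix l
    have "summable (\<lambda>k. passage_prob N c ?b (Suc k) l * ?z ^ Suc k)"
      using H_series_abs_summable[OF assms(1,2), of ?z ?b l] conv
      by (auto intro: summable_rabs_cancel)
    then show "(\<lambda>k. passage_prob N c ?b (Suc k) l * ?z ^ Suc k) sums H_series N c ?b l ?z"
      unfolding H_series_def by (rule summable_sums)
  qed
  ultimately show ?thesis by simp
qed

end

theory Submission
  imports Defs
begin

text \<open>For \<open>0 < z < 1\<close> consider the equation \<open>z * step_gf N c x = 1\<close>, where \<open>step_gf\<close> is the generating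
  function of one step. It reads \<open>- c * (-1) ^ N * (1 - x) ^ (2 * N) / x ^ N = 1 / z - 1\<close>, is
  invariant under \<open>x \<mapsto> 1 / x\<close>, and has exactly \<open>N\<close> solutions outside the unit circle. They are
  explicit: with \<open>c * r ^ (2 * N) = 1 / z - 1\<close> the \<open>j\<close>-th one is \<open>x\<^sub>j = A\<^sup>2\<close>, where
  \<open>A - 1 / A = r * phi N j\<close> and \<open>norm A > 1\<close> (\<open>outer_root\<close>). These solutions are distinct for every
  \<open>z\<close> in \<open>(0, 1)\<close> and depend analytically on \<open>z\<close>.

  For small \<open>z\<close>, optional stopping of the martingale \<open>z ^ n * x\<^sub>j powi walk u n\<close> shows that
  \<open>\<Sum>l. H l * x\<^sub>j powi l = 1\<close> for the \<open>N\<close> numbers \<open>H l = H_series N c \<beta> l z\<close>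
  (\<open>H_series_optional_stopping\<close>). So the polynomial with coefficients \<open>H (\<beta> + i)\<close>, of degree below
  \<open>N\<close>, interpolates \<open>x powi (- \<beta>)\<close> at the \<open>N\<close> outer roots. The Lagrange formula makes sense on all of
  \<open>(0, 1)\<close>, its coefficients are analytic there, and hence they are the values \<open>H_plus\<close> of the
  continuation (\<open>H_plus_eq_coeff_passage_poly\<close>).

  The transform is therefore \<open>x powi \<beta>\<close> times the value of the Lagrange polynomial at
  \<open>x = exp (\<i> * \<mu> * \<epsilon>)\<close>. For \<open>z = exp (- lam * \<epsilon> ^ (2 * N))\<close> and \<open>\<rho> = root (2 * N) (lam / c)\<close> one has
  \<open>r / \<epsilon> \<longlonglongrightarrow> \<rho>\<close>, so \<open>(x\<^sub>j - 1) / \<epsilon>\<close> tends to \<open>\<rho> * phi N j\<close>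
  (\<open>tendsto_outer_root_quotient\<close>). Consequently \<open>x\<^sub>j powi (- \<beta>)\<close> tends to \<open>exp (- phi N j * \<rho> * b)\<close>, and
  each Lagrange factor \<open>(x - x\<^sub>j) / (x\<^sub>k - x\<^sub>j)\<close> tends to
  \<open>(\<i> * \<mu> - \<rho> * phi N j) / (\<rho> * phi N k - \<rho> * phi N j)\<close>, which gives the stated formula.\<close>

section \<open>Real-analytic functions from complex-analytic ones\<close>

text \<open>On the real line, taking real parts of the Taylor coefficients of \<open>f\<close> gives the Taylor
  coefficients of \<open>Re f\<close>, and this does not shrink the disc of convergence.\<close>

lemma analytic_imp_Re_real_analytic_on:
  assumes "\<And>x. x \<in> S \<Longrightarrow> f analytic_on {complex_of_real x}"
  shows "(\<lambda>x. Re (f (complex_of_real x))) real_analytic_on S"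
  unfolding real_analytic_on_def
proof
  fix x assume "x \<in> S"
  from analytic_at_imp_has_fps_expansion[OF assms[OF this]]
  obtain F where F: "(\<lambda>h. f (complex_of_real x + h)) has_fps_expansion F"
    by blast
  define R where "R = Abs_fps (\<lambda>n. Re (fps_nth F n))"
  have "conv_radius (fps_nth F) \<le> conv_radius (fps_nth R)"
  proof (rule conv_radius_geI_ex')
    fix r assume r: "0 < r" "ereal r < conv_radius (fps_nth F)"
    then have "summable (\<lambda>n. Re (fps_nth F n * of_real r ^ n))"
      by (intro summable_Re summable_in_conv_radius) auto
    then show "summable (\<lambda>n. fps_nth R n * of_real r ^ n)"
      by (simp add: R_def flip: of_real_power)
  qed
  moreover have posF: "fps_conv_radius F > 0" and ev: "\<forall>\<^sub>F h in nhds 0. eval_fps F h = f (complex_of_real x + h)"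
    using F by (auto simp: has_fps_expansion_def)
  ultimately have posR: "fps_conv_radius R > 0"
    by (simp add: fps_conv_radius_def)
  have "complex_of_real \<midarrow>0\<rightarrow> complex_of_real 0" by (intro tendsto_intros)
  then have lim: "filterlim complex_of_real (nhds 0) (nhds 0)"
    unfolding tendsto_at_iff_tendsto_nhds by simp
  have "\<forall>\<^sub>F z in nhds (0::complex). z \<in> eball 0 (fps_conv_radius F)"
    using posF by (intro eventually_nhds_in_open) (auto simp: zero_ereal_def)
  then have "\<forall>\<^sub>F z in nhds 0. ereal (norm z) < fps_conv_radius F \<and> eval_fps F z = f (complex_of_real x + z)"
    using ev by eventually_elim auto
  from eventually_compose_filterlim[OF this lim]
  have "\<forall>\<^sub>F h in nhds 0. eval_fps R h = Re (f (complex_of_real (x + h)))"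
  proof eventually_elim
    fix h :: real
    assume h: "ereal (norm (complex_of_real h)) < fps_conv_radius F \<and>
      eval_fps F (complex_of_real h) = f (complex_of_real x + complex_of_real h)"
    then have "(\<lambda>n. fps_nth F n * complex_of_real h ^ n) sums f (complex_of_real (x + h))"
      using sums_eval_fps[of "complex_of_real h" F] by simp
    then have "(\<lambda>n. fps_nth R n * h ^ n) sums Re (f (complex_of_real (x + h)))"
      by (auto dest!: sums_Re simp: R_def simp flip: of_real_power)
    then show "eval_fps R h = Re (f (complex_of_real (x + h)))"
      by (simp add: eval_fps_def sums_iff)
  qed
  with posR show "\<exists>F. (\<lambda>h. Re (f (complex_of_real (x + h)))) has_fps_expansion F"
    by (auto simp: has_fps_expansion_def)
qed

section \<open>Lagrange interpolation\<close>

definition lagrange_poly :: "'i set \<Rightarrow> ('i \<Rightarrow> 'a::field) \<Rightarrow> ('i \<Rightarrow> 'a) \<Rightarrow> 'a poly" where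
  "lagrange_poly I x v =
     (\<Sum>k\<in>I. smult (v k) (\<Prod>j\<in>I - {k}. smult (1 / (x k - x j)) [:- x j, 1:]))"

lemma poly_lagrange_poly:
  "poly (lagrange_poly I x v) t = (\<Sum>k\<in>I. v k * (\<Prod>j\<in>I - {k}. (t - x j) / (x k - x j)))"
  by (simp add: lagrange_poly_def poly_sum poly_prod diff_divide_distrib)

lemma poly_lagrange_poly_node:
  assumes "finite I" "inj_on x I" "i \<in> I"
  shows "poly (lagrange_poly I x v) (x i) = v i"
proof -
  have "(\<Prod>j\<in>I - {k}. (x i - x j) / (x k - x j)) = (if k = i then 1 else 0)" if "k \<in> I" for k
  proof (cases "k = i")
    case True
    then show ?thesis
      using assms by (auto intro!: prod.neutral simp: inj_on_eq_iff)
  next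
    case False
    then have "i \<in> I - {k}" using assms by auto
    then show ?thesis using False assms by (auto intro!: prod_zero)
  qed
  then have "poly (lagrange_poly I x v) (x i) = (\<Sum>k\<in>I. v k * (if k = i then 1 else 0))"
    unfolding poly_lagrange_poly by (intro sum.cong) simp_all
  also have "\<dots> = v i"
    using assms by (simp add: if_distrib cong: if_cong)
  finally show ?thesis .
qed

lemma degree_lagrange_poly:
  assumes "finite I" "I \<noteq> {}"
  shows "degree (lagrange_poly I x v) < card I"
  unfolding lagrange_poly_def
proof (rule degree_sum_less)
  show "0 < card I" using assms by (simp add: card_gt_0_iff)
  fix k assume k: "k \<in> I"
  have "degree (\<Prod>j\<in>I - {k}. smult (1 / (x k - x j)) [:- x j, 1:])
      \<le> (\<Sum>j\<in>I - {k}. degree (smult (1 / (x k - x j)) [:- x j, 1:]))"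
    using degree_prod_sum_le[of "I - {k}" "\<lambda>j. smult (1 / (x k - x j)) [:- x j, 1:]"] assms
    by (simp add: o_def)
  also have "\<dots> \<le> (\<Sum>j\<in>I - {k}. 1)" by (intro sum_mono) auto
  also have "\<dots> < card I" using k assms by (simp add: card_gt_0_iff)
  finally show "degree (smult (v k) (\<Prod>j\<in>I - {k}. smult (1 / (x k - x j)) [:- x j, 1:])) < card I"
    by (meson degree_smult_le le_less_trans)
qed

lemma analytic_on_coeff_prod:
  assumes "\<And>j n. j \<in> J \<Longrightarrow> (\<lambda>z. coeff (p j z) n) analytic_on A"
  shows "(\<lambda>z. coeff (\<Prod>j\<in>J. p j z) n) analytic_on A"
  using assms
proof (induction J arbitrary: n rule: infinite_finite_induct)
  case (insert i J)
  then show ?case by (auto simp: coeff_mult intro!: analytic_intros)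
qed simp_all

text \<open>Where the nodes stay distinct, the coefficients of the interpolation polynomial are polynomial
  expressions in the nodes, the values and the reciprocals of the node differences.\<close>

lemma analytic_on_coeff_lagrange_poly:
  assumes "\<And>i. i \<in> I \<Longrightarrow> (\<lambda>z. x z i) analytic_on A" "\<And>i. i \<in> I \<Longrightarrow> (\<lambda>z. v z i) analytic_on A"
    and "\<And>z. z \<in> A \<Longrightarrow> inj_on (x z) I"
  shows "(\<lambda>z. coeff (lagrange_poly I (x z) (v z)) n) analytic_on A"
  unfolding lagrange_poly_def coeff_sum coeff_smult
proof (intro analytic_intros analytic_on_coeff_prod assms)
  fix k j m assume "k \<in> I" "j \<in> I - {k}"
  then have "(\<lambda>z. 1 / (x z k - x z j)) analytic_on A"
    using assms by (intro analytic_intros) (auto dest: inj_onD)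
  moreover have "(\<lambda>z. coeff [:- x z j, 1:] m) analytic_on A"
    using \<open>j \<in> I - {k}\<close> assms(1)
    by (cases m) (auto simp: coeff_pCons intro!: analytic_intros)
  ultimately show "(\<lambda>z. coeff (smult (1 / (x z k - x z j)) [:- x z j, 1:]) m) analytic_on A"
    unfolding coeff_smult by (rule analytic_on_mult)
qed

section \<open>Optional stopping for the pseudo-random walk\<close>

definition step_gf :: "nat \<Rightarrow> real \<Rightarrow> complex \<Rightarrow> complex" where
  "step_gf N c x = (\<Sum>k\<in>{- int N..int N}. of_real (step_weight N c k) * x powi k)"

definition survival_gf :: "nat \<Rightarrow> real \<Rightarrow> int \<Rightarrow> nat \<Rightarrow> complex \<Rightarrow> complex" where
  "survival_gf N c \<beta> n x =
     (\<Sum>u\<in>{u \<in> steps N n. \<forall>j\<in>{1..n}. walk u j < \<beta>}.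
        of_real (\<Prod>j=1..n. step_weight N c (u j)) * x powi walk u n)"

definition passage_gf :: "nat \<Rightarrow> real \<Rightarrow> int \<Rightarrow> nat \<Rightarrow> complex \<Rightarrow> complex" where
  "passage_gf N c \<beta> n x =
     (\<Sum>l\<in>{\<beta>..\<beta> + int N - 1}. of_real (passage_prob N c \<beta> n l) * x powi l)"

lemma finite_steps: "finite (steps N n)"
  by (auto simp: steps_def intro!: finite_PiE)

lemma sum_steps_Suc:
  "(\<Sum>u\<in>steps N (Suc n). f u) = (\<Sum>u\<in>steps N n. \<Sum>k\<in>{- int N..int N}. f (u(Suc n := k)))"
proof -
  have "steps N (Suc n) = (\<lambda>(k, u). u(Suc n := k)) ` ({- int N..int N} \<times> steps N n)"
    by (simp add: steps_def atLeastAtMostSuc_conv PiE_insert_eq)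
  moreover have "inj_on (\<lambda>(k, u). u(Suc n := k)) ({- int N..int N} \<times> steps N n)"
    unfolding steps_def by (rule inj_combinator) simp
  ultimately have "(\<Sum>u\<in>steps N (Suc n). f u)
      = (\<Sum>(k, u)\<in>{- int N..int N} \<times> steps N n. f (u(Suc n := k)))"
    by (simp add: sum.reindex o_def case_prod_unfold)
  also have "\<dots> = (\<Sum>k\<in>{- int N..int N}. \<Sum>u\<in>steps N n. f (u(Suc n := k)))"
    by (simp add: sum.cartesian_product)
  finally show ?thesis by (simp add: sum.swap[of _ "steps N n"])
qed

lemma walk_upd:
  "j \<le> n \<Longrightarrow> walk (u(Suc n := k)) j = walk u j"
  "walk (u(Suc n := k)) (Suc n) = walk u n + k"
  by (auto simp: walk_def intro!: sum.cong)

text \<open>One step of the walk, started from a path that has stayed below the level \<open>\<beta>\<close>, either keeps it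
  below or makes it pass for the first time. As a step is at most \<open>N\<close>, a passing path lands in
  \<open>{\<beta>..\<beta> + N - 1}\<close>, so the passage term contains all of them.\<close>

lemma survival_gf_step:
  assumes "N \<ge> 1" "\<beta> \<ge> 1" "x \<noteq> 0"
  shows "survival_gf N c \<beta> n x * step_gf N c x
       = survival_gf N c \<beta> (Suc n) x + passage_gf N c \<beta> (Suc n) x"
proof -
  let ?K = "{- int N..int N}" and ?L = "{\<beta>..\<beta> + int N - 1}"
  let ?F = "\<lambda>n u. of_real (\<Prod>j=1..n. step_weight N c (u j)) * x powi walk u n :: complex"
  let ?ok = "\<lambda>u. \<forall>j\<in>{1..n}. walk u j < \<beta>"
  let ?T = "{u \<in> steps N (Suc n). ?ok u}"
  have 1: "survival_gf N c \<beta> n x * step_gf N c x = (\<Sum>u\<in>?T. ?F (Suc n) u)"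
  proof -
    have "(\<Sum>u\<in>?T. ?F (Suc n) u) = (\<Sum>u\<in>steps N (Suc n). if ?ok u then ?F (Suc n) u else 0)"
      by (subst sum.inter_filter) (simp_all only: finite_steps)
    also have "\<dots> = (\<Sum>u\<in>steps N n. if ?ok u then
        (\<Sum>k\<in>?K. ?F n u * (of_real (step_weight N c k) * x powi k)) else 0)"
      unfolding sum_steps_Suc
    proof (rule sum.cong[OF refl], goal_cases)
      case (1 u)
      have "?ok (u(Suc n := k)) = ?ok u" for k by (simp add: walk_upd)
      moreover have "?F (Suc n) (u(Suc n := k)) = ?F n u * (of_real (step_weight N c k) * x powi k)" for k
        unfolding walk_upd(2) using assms(3) by (simp add: power_int_add mult_ac)
      ultimately show ?case by (simp only: if_distrib sum.neutral_const cong: if_cong) simp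
    qed
    also have "\<dots> = survival_gf N c \<beta> n x * step_gf N c x"
      unfolding survival_gf_def step_gf_def sum_product
      by (subst sum.inter_filter[OF finite_steps]) simp
    finally show ?thesis by (rule sym)
  qed
  let ?T1 = "{u \<in> ?T. walk u (Suc n) < \<beta>}" and ?T2 = "{u \<in> ?T. \<beta> \<le> walk u (Suc n)}"
  have fin: "finite ?T" by (simp add: finite_steps)
  have 2: "(\<Sum>u\<in>?T. ?F (Suc n) u) = (\<Sum>u\<in>?T1. ?F (Suc n) u) + (\<Sum>u\<in>?T2. ?F (Suc n) u)"
    using fin by (subst sum.union_disjoint[symmetric]) (auto simp: finite_steps intro!: sum.cong)
  have 3: "(\<Sum>u\<in>?T1. ?F (Suc n) u) = survival_gf N c \<beta> (Suc n) x"
    unfolding survival_gf_def by (rule sum.cong) (auto simp: le_Suc_eq)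
  have range: "walk u (Suc n) \<in> ?L" if "u \<in> ?T2" for u
  proof -
    have "walk u (Suc n) = walk u n + u (Suc n)" by (simp add: walk_def)
    moreover have "u (Suc n) \<le> int N" using that by (auto simp: steps_def PiE_iff)
    moreover have "walk u n < \<beta>"
      using that assms by (cases "n = 0") (auto simp: walk_def)
    ultimately show ?thesis using that by auto
  qed
  have "(\<Sum>u\<in>?T2. ?F (Suc n) u) = (\<Sum>l\<in>?L. \<Sum>u\<in>{u \<in> ?T2. walk u (Suc n) = l}. ?F (Suc n) u)"
    using range fin by (intro sum.group[symmetric]) (auto simp: finite_steps)
  also have "\<dots> = passage_gf N c \<beta> (Suc n) x"
    unfolding passage_gf_def
  proof (rule sum.cong[OF refl], goal_cases)
    case (1 l)
    then have "{u \<in> ?T2. walk u (Suc n) = l} = steps N (Suc n) \<inter> passage_event \<beta> (Suc n) l"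
      by (auto simp: passage_event_def)
    then show ?case
      unfolding passage_prob_def pprob_def of_real_sum sum_distrib_right
      by (intro sum.cong) (auto simp: passage_event_def)
  qed
  finally show ?thesis using 1 2 3 by simp
qed

lemma norm_survival_gf_le:
  assumes "\<beta> \<ge> 1" "norm x \<ge> 1"
  shows "norm (survival_gf N c \<beta> n x) \<le> total_weight N c ^ n * norm x powi \<beta>"
proof -
  have "norm (survival_gf N c \<beta> n x)
      \<le> (\<Sum>u\<in>{u \<in> steps N n. \<forall>j\<in>{1..n}. walk u j < \<beta>}.
          (\<Prod>j=1..n. \<bar>step_weight N c (u j)\<bar>) * norm x powi \<beta>)"
    unfolding survival_gf_def
  proof (rule sum_norm_le)
    fix u assume "u \<in> {u \<in> steps N n. \<forall>j\<in>{1..n}. walk u j < \<beta>}"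
    then have "walk u n \<le> \<beta>" using assms(1) by (cases "n = 0") (auto simp: walk_def intro: less_imp_le)
    then have "norm x powi walk u n \<le> norm x powi \<beta>" using assms(2) by (intro power_int_increasing)
    then show "norm (of_real (\<Prod>j=1..n. step_weight N c (u j)) * x powi walk u n)
        \<le> (\<Prod>j=1..n. \<bar>step_weight N c (u j)\<bar>) * norm x powi \<beta>"
      by (auto simp: norm_mult norm_power_int prod_norm[symmetric] intro!: mult_left_mono prod_nonneg)
  qed
  also have "\<dots> \<le> (\<Sum>u\<in>steps N n. (\<Prod>j=1..n. \<bar>step_weight N c (u j)\<bar>) * norm x powi \<beta>)"
    by (intro sum_mono2) (auto simp: finite_steps intro!: mult_nonneg_nonneg prod_nonneg)
  also have "\<dots> = (\<Prod>j=1..n. total_weight N c) * norm x powi \<beta>"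
    unfolding steps_def total_weight_def sum_distrib_right[symmetric] by (subst prod_sum_PiE) auto
  finally show ?thesis by simp
qed

text \<open>If \<open>z * step_gf N c x = 1\<close>, then \<open>z ^ n * x powi walk u n\<close> is a martingale for the pseudo-random
  walk. For \<open>norm x \<ge> 1\<close> it is bounded by \<open>z ^ n * norm x powi \<beta>\<close> on paths below \<open>\<beta>\<close>. The total
  variation of the weights is at most \<open>total_weight N c ^ n\<close>, so for \<open>z < 1 / total_weight N c\<close>
  the surviving paths contribute nothing in the limit, and the initial value \<open>1\<close> of the martingale
  is its pseudo-expectation at the passage time.\<close>

lemma H_series_optional_stopping:
  assumes "N \<ge> 1" "c > 0" "\<beta> \<ge> 1" "0 < z" "z < 1 / total_weight N c" "norm x \<ge> 1"
    and root: "of_real z * step_gf N c x = 1"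
  shows "(\<Sum>l\<in>{\<beta>..\<beta> + int N - 1}. of_real (H_series N c \<beta> l z) * x powi l) = 1"
proof -
  let ?L = "{\<beta>..\<beta> + int N - 1}" and ?M = "total_weight N c"
  have x: "x \<noteq> 0" using assms(6) by auto
  have M: "?M > 0" using total_weight_pos assms by blast
  \<comment> \<open>the part of the martingale carried by the paths that have not yet passed the level\<close>
  define D where "D n = of_real z ^ n * survival_gf N c \<beta> n x" for n
  have step: "of_real z ^ Suc n * passage_gf N c \<beta> (Suc n) x = D n - D (Suc n)" for n
  proof -
    have "D n = of_real z ^ Suc n * (survival_gf N c \<beta> n x * step_gf N c x)"
      using root by (simp add: D_def)
    then show ?thesis
      unfolding survival_gf_step[OF assms(1,3) x] by (simp add: D_def algebra_simps)
  qed
  have D0: "D 0 = 1"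
    by (simp add: D_def survival_gf_def steps_def walk_def)
  have "D \<longlonglongrightarrow> 0"
  proof (rule Lim_null_comparison)
    show "\<forall>\<^sub>F n in sequentially. norm (D n) \<le> (z * ?M) ^ n * norm x powi \<beta>"
    proof (rule always_eventually, rule allI)
      fix n
      have "z ^ n * norm (survival_gf N c \<beta> n x) \<le> z ^ n * (?M ^ n * norm x powi \<beta>)"
        using norm_survival_gf_le[OF assms(3,6)] assms(4) by (intro mult_left_mono) auto
      then show "norm (D n) \<le> (z * ?M) ^ n * norm x powi \<beta>"
        using assms(4) by (simp add: D_def norm_mult norm_power power_mult_distrib mult_ac)
    qed
    have "z * ?M < 1" using assms(5) M by (simp add: field_simps)
    then have "(\<lambda>n. (z * ?M) ^ n) \<longlonglongrightarrow> 0"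
      using assms(4) M by (intro LIMSEQ_realpow_zero) auto
    then show "(\<lambda>n. (z * ?M) ^ n * norm x powi \<beta>) \<longlonglongrightarrow> 0"
      by (rule tendsto_mult_left_zero)
  qed
  then have "(\<lambda>n. D n - D (Suc n)) sums (D 0 - 0)"
    by (rule telescope_sums')
  then have "(\<lambda>n. of_real z ^ Suc n * passage_gf N c \<beta> (Suc n) x) sums 1"
    unfolding step using D0 by simp
  moreover have "(\<lambda>n. of_real z ^ Suc n * passage_gf N c \<beta> (Suc n) x)
      sums (\<Sum>l\<in>?L. of_real (H_series N c \<beta> l z) * x powi l)"
  proof -
    have "(\<lambda>n. \<Sum>l\<in>?L. of_real (passage_prob N c \<beta> (Suc n) l * z ^ Suc n) * x powi l)
        sums (\<Sum>l\<in>?L. of_real (H_series N c \<beta> l z) * x powi l)"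
    proof (intro sums_sum sums_mult2 sums_of_real)
      fix l
      have "\<bar>z\<bar> < 1 / ?M" using assms by simp
      from H_series_abs_summable[OF assms(1,2) this, of \<beta> l]
      show "(\<lambda>n. passage_prob N c \<beta> (Suc n) l * z ^ Suc n) sums H_series N c \<beta> l z"
        unfolding H_series_def by (rule summable_sums[OF summable_rabs_cancel])
    qed
    moreover have "of_real z ^ Suc n * passage_gf N c \<beta> (Suc n) x
        = (\<Sum>l\<in>?L. of_real (passage_prob N c \<beta> (Suc n) l * z ^ Suc n) * x powi l)" for n
      by (simp add: passage_gf_def sum_distrib_left mult_ac)
    ultimately show ?thesis by simp
  qed
  ultimately show ?thesis by (rule sums_unique2[symmetric])
qed

section \<open>The roots outside the unit circle\<close>

lemma phi_angle_bounds:
  assumes "j \<in> {1..N}"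
  shows "0 < (2 * real j - 1) / (2 * real N) * pi" "(2 * real j - 1) / (2 * real N) * pi < pi"
proof -
  have "real j \<ge> 1" "real j \<le> real N" using assms by auto
  then have "0 < (2 * real j - 1) / (2 * real N)" "(2 * real j - 1) / (2 * real N) < 1"
    by (simp_all add: field_simps)
  then show "0 < (2 * real j - 1) / (2 * real N) * pi" "(2 * real j - 1) / (2 * real N) * pi < pi"
    using mult_strict_right_mono[of _ 1 pi] mult_pos_pos[of _ pi] by (metis mult_1 pi_gt_zero)+
qed

lemma Re_phi_pos: "j \<in> {1..N} \<Longrightarrow> Re (phi N j) > 0"
proof -
  assume j: "j \<in> {1..N}"
  have "phi N j = - \<i> * cis ((2 * real j - 1) / (2 * real N) * pi)"
    by (simp add: phi_def cis_conv_exp)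
  moreover have "sin ((2 * real j - 1) / (2 * real N) * pi) > 0"
    using phi_angle_bounds[OF j] by (intro sin_gt_zero)
  ultimately show ?thesis by simp
qed

lemma norm_phi: "norm (phi N j) = 1"
  by (simp add: phi_def norm_mult)

lemma phi_power: "N \<ge> 1 \<Longrightarrow> phi N j ^ (2 * N) = - ((- 1) ^ N)"
proof -
  assume N: "N \<ge> 1"
  have "phi N j ^ (2 * N) = (- \<i>) ^ (2 * N) * cis ((2 * real j - 1) / (2 * real N) * pi) ^ (2 * N)"
    by (simp add: phi_def cis_conv_exp power_mult_distrib)
  moreover have "real (2 * N) * ((2 * real j - 1) / (2 * real N) * pi) = 2 * real j * pi - pi"
    using N by (simp add: field_simps)
  then have "cis ((2 * real j - 1) / (2 * real N) * pi) ^ (2 * N) = cis (2 * real j * pi - pi)"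
    by (simp only: Complex.DeMoivre)
  moreover have "cis (2 * real j * pi - pi) = - 1"
    by (simp add: complex_eq_iff cos_diff sin_diff)
  ultimately show ?thesis by (simp add: power_mult)
qed

lemma inj_on_phi: "inj_on (phi N) {1..N}"
proof (rule inj_onI)
  fix j k assume jk: "j \<in> {1..N}" "k \<in> {1..N}" "phi N j = phi N k"
  let ?t = "\<lambda>j. (2 * real j - 1) / (2 * real N) * pi"
  have "cis (?t j) = cis (?t k)"
    using jk(3) by (simp add: phi_def cis_conv_exp)
  then have "cos (?t j) = cos (?t k)"
    by (simp add: complex_eq_iff)
  then have "?t j = ?t k"
    by (rule cos_inj_pi[rotated 4])
      (simp_all only: less_imp_le[OF phi_angle_bounds(1)] less_imp_le[OF phi_angle_bounds(2)] jk(1,2))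
  then show "j = k" using jk(1,2) by simp
qed

text \<open>The solution of \<open>A - 1 / A = 2 * w\<close> that lies outside the unit circle when \<open>Re w > 0\<close>. The
  principal square root makes it analytic in that half-plane.\<close>

definition exp_arsinh :: "complex \<Rightarrow> complex" where
  "exp_arsinh w = w + csqrt (1 + w\<^sup>2)"

lemma exp_arsinh_mult: "exp_arsinh w * (exp_arsinh w - 2 * w) = 1"
proof -
  have "exp_arsinh w * (exp_arsinh w - 2 * w) = (csqrt (1 + w\<^sup>2))\<^sup>2 - w\<^sup>2"
    by (simp add: exp_arsinh_def power2_eq_square algebra_simps del: power2_csqrt)
  then show ?thesis by simp
qed

text \<open>Put \<open>A = exp_arsinh w\<close>. The real part of \<open>A - 1 / A = 2 * w\<close> is
  \<open>Re A * (1 - 1 / (norm A)\<^sup>2)\<close>; it is positive, and so is \<open>Re A\<close>.\<close>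

lemma norm_exp_arsinh_gt_1:
  assumes "Re w > 0"
  shows "norm (exp_arsinh w) > 1"
proof -
  let ?A = "exp_arsinh w"
  have nz: "?A \<noteq> 0" using exp_arsinh_mult[of w] by auto
  have "Re ?A > 0" using assms csqrt_principal[of "1 + w\<^sup>2"] 
    by (auto simp: exp_arsinh_def simp del: csqrt.simps)
  have "inverse ?A = ?A - 2 * w"
    using exp_arsinh_mult[of w] nz by (simp add: field_simps)
  then have "Re (inverse ?A) < Re ?A" using assms by (simp del: inverse_complex.sel)
  moreover have inv: "Re (inverse ?A) = Re ?A / (norm ?A)\<^sup>2"
    by (simp add: cmod_power2)
  ultimately have "Re ?A / (norm ?A)\<^sup>2 < Re ?A" by (simp only: inv)
  then have "(norm ?A)\<^sup>2 > 1\<^sup>2"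
    using \<open>Re ?A > 0\<close> nz by (simp add: divide_less_eq)
  then show ?thesis by (rule power_less_imp_less_base) simp
qed

lemma one_plus_square_notin_nonpos_Reals:
  assumes "Re w > 0"
  shows "1 + w\<^sup>2 \<notin> \<real>\<^sub>\<le>\<^sub>0"
proof
  assume "1 + w\<^sup>2 \<in> \<real>\<^sub>\<le>\<^sub>0"
  then have "Re (w\<^sup>2) \<le> - 1" "Im (w\<^sup>2) = 0"
    by (auto simp: complex_nonpos_Reals_iff)
  then have "(Re w)\<^sup>2 - (Im w)\<^sup>2 \<le> - 1" "Im w = 0"
    using assms by (simp_all add: Re_power2 Im_power2)
  then show False using zero_le_power2[of "Re w"] by simp
qed

text \<open>For \<open>x = outer_root N r j\<close> one has \<open>(1 - x)\<^sup>2 / x = (r * phi N j)\<^sup>2\<close>. The equation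
  \<open>z * step_gf N c x = 1\<close> fixes only the \<open>N\<close>-th power of the left-hand side, and the \<open>N\<close> values
  \<open>(phi N j)\<^sup>2\<close> run through the \<open>N\<close>-th roots of \<open>(-1) ^ (N - 1)\<close>.\<close>

definition outer_root :: "nat \<Rightarrow> complex \<Rightarrow> nat \<Rightarrow> complex" where
  "outer_root N r j = (exp_arsinh (r * phi N j / 2))\<^sup>2"

lemma exp_arsinh_square_minus_1: "(exp_arsinh w)\<^sup>2 - 1 = 2 * w * exp_arsinh w"
  using exp_arsinh_mult[of w] by (simp add: power2_eq_square algebra_simps)

lemma outer_root_diff_1:
  "outer_root N r j - 1 = r * phi N j * exp_arsinh (r * phi N j / 2)"
  by (simp add: outer_root_def exp_arsinh_square_minus_1)

lemma norm_outer_root_gt_1: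
  assumes "r > 0" "j \<in> {1..N}"
  shows "norm (outer_root N (of_real r) j) > 1"
proof -
  have "norm (exp_arsinh (of_real r * phi N j / 2)) > 1"
    using assms Re_phi_pos[OF assms(2)] by (intro norm_exp_arsinh_gt_1) simp
  then show ?thesis by (simp add: outer_root_def norm_power)
qed

text \<open>The root \<open>outer_root N r j\<close> determines \<open>(r * phi N j)\<^sup>2\<close>, hence \<open>phi N j\<close> up to sign, and the sign is
  fixed by \<open>Re (phi N j) > 0\<close>.\<close>

lemma inj_on_outer_root:
  assumes "r > 0"
  shows "inj_on (outer_root N (of_real r)) {1..N}"
proof (rule inj_onI)
  fix j k assume jk: "j \<in> {1..N}" "k \<in> {1..N}"
    and eq: "outer_root N (of_real r) j = outer_root N (of_real r) k"
  have sq: "(outer_root N (of_real r) i - 1)\<^sup>2 = outer_root N (of_real r) i * (of_real r * phi N i)\<^sup>2" for i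
    unfolding outer_root_diff_1 by (simp add: outer_root_def power_mult_distrib)
  have "outer_root N (of_real r) j \<noteq> 0"
    using norm_outer_root_gt_1[OF assms jk(1)] by auto
  then have "(of_real r * phi N j)\<^sup>2 = (of_real r * phi N k)\<^sup>2"
    using sq[of j] sq[of k] eq by simp
  then have "phi N j = phi N k \<or> phi N j = - phi N k"
    using assms by (simp add: power_mult_distrib power2_eq_iff)
  moreover have "phi N j \<noteq> - phi N k"
    using Re_phi_pos[OF jk(1)] Re_phi_pos[OF jk(2)] by (auto simp: complex_eq_iff)
  ultimately show "j = k" using inj_onD[OF inj_on_phi _ jk(1,2)] by auto
qed

text \<open>The weights are signed binomial coefficients, so the binomial theorem sums them in closed form.\<close>

lemma step_gf_eq:
  assumes "x \<noteq> 0"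
  shows "step_gf N c x = 1 - of_real c * (- 1) ^ N * (1 - x) ^ (2 * N) / x ^ N"
proof -
  let ?K = "{- int N..int N}"
  have "step_gf N c x = (\<Sum>k\<in>?K. (if k = 0 then 1 else 0)
      + of_real c * ((- 1) powi (k - 1) * of_nat ((2 * N) choose nat (k + int N)) * x powi k))"
    unfolding step_gf_def by (rule sum.cong) (auto simp: step_weight_def algebra_simps)
  also have "\<dots> = 1 + of_real c *
      (\<Sum>k\<in>?K. (- 1) powi (k - 1) * of_nat ((2 * N) choose nat (k + int N)) * x powi k)"
    by (simp add: sum.distrib sum_distrib_left)
  also have "(\<Sum>k\<in>?K. (- 1) powi (k - 1) * of_nat ((2 * N) choose nat (k + int N)) * x powi k)
      = (\<Sum>m\<le>2 * N. - ((- 1) ^ N) / x ^ N * (of_nat ((2 * N) choose m) * (- x) ^ m * 1 ^ (2 * N - m)))"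
  proof (rule sum.reindex_bij_witness[of _ "\<lambda>m. int m - int N" "\<lambda>k. nat (k + int N)"], goal_cases)
    case (5 k)
    define m where "m = nat (k + int N)"
    have k: "k = int m - int N" using 5 by (simp add: m_def)
    have "x powi k = x ^ m / x ^ N"
      unfolding k using assms by (simp add: power_int_diff)
    moreover have "(- 1 :: complex) powi (k - 1) = - ((- 1) ^ N * (- 1) ^ m)"
      unfolding k by (auto simp: power_int_diff uminus_power_if)
    ultimately show ?case
      by (simp add: m_def[symmetric] power_minus[of x] mult_ac)
  qed auto
  also have "\<dots> = - ((- 1) ^ N) / x ^ N * (- x + 1) ^ (2 * N)"
    by (simp only: binomial_ring sum_distrib_left)
  finally show ?thesis by simp
qed

lemma step_gf_outer_root:
  assumes "N \<ge> 1" "r > 0" "j \<in> {1..N}"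
  shows "step_gf N c (outer_root N (of_real r) j) = 1 + of_real (c * r ^ (2 * N))"
proof -
  let ?x = "outer_root N (of_real r) j"
  have x: "?x \<noteq> 0" using norm_outer_root_gt_1[OF assms(2,3)] by auto
  have "(1 - ?x) ^ (2 * N) = (?x - 1) ^ (2 * N)"
    by (simp add: power_mult power2_commute)
  also have "\<dots> = of_real r ^ (2 * N) * phi N j ^ (2 * N) * ?x ^ N"
    unfolding outer_root_diff_1 by (simp only: power_mult_distrib outer_root_def power_mult)
  finally have "(1 - ?x) ^ (2 * N) / ?x ^ N = - of_real (r ^ (2 * N)) * (- 1) ^ N"
    using x phi_power[OF assms(1)] by simp
  then have "step_gf N c ?x = 1 + of_real (c * r ^ (2 * N)) * ((- 1) ^ N * (- 1) ^ N)"
    unfolding step_gf_eq[OF x] times_divide_eq_right[symmetric] by simp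
  then show ?thesis by (simp flip: power_mult_distrib)
qed

text \<open>The parameter \<open>r\<close> of \<open>outer_root\<close> for which \<open>c * r ^ (2 * N) = 1 / z - 1\<close>; it is stated for complex
  \<open>z\<close> in order to speak of analyticity near the real interval \<open>(0, 1)\<close>.\<close>

definition radius :: "nat \<Rightarrow> real \<Rightarrow> complex \<Rightarrow> complex" where
  "radius N c z = ((1 / z - 1) / of_real c) powr (1 / of_nat (2 * N))"

lemma radius_of_real:
  assumes "N \<ge> 1" "c > 0" "0 < z" "z < 1"
  shows "radius N c (of_real z) = of_real (root (2 * N) ((1 / z - 1) / c))"
proof -
  have "(1 / z - 1) / c > 0" using assms by simp
  moreover have "(1 / of_real z - 1) / of_real c = complex_of_real ((1 / z - 1) / c)" by simp
  moreover have "1 / of_nat (2 * N) = complex_of_real (1 / real (2 * N))" by simp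
  ultimately show ?thesis
    unfolding radius_def using assms
    by (simp only: powr_of_real root_powr_inverse)
qed

section \<open>The analytic continuation of the passage generating functions\<close>

text \<open>For small \<open>z\<close>, its coefficients are the values \<open>H_series N c \<beta> (\<beta> + i) z\<close>: optional stopping says that
  the polynomial with these coefficients takes the value \<open>x powi (- \<beta>)\<close> at each of the \<open>N\<close> outer
  roots \<open>x\<close>.\<close>

definition passage_poly :: "nat \<Rightarrow> real \<Rightarrow> int \<Rightarrow> complex \<Rightarrow> complex poly" where
  "passage_poly N c \<beta> z =
     lagrange_poly {1..N} (outer_root N (radius N c z)) (\<lambda>j. outer_root N (radius N c z) j powi (- \<beta>))"

text \<open>For every real \<open>z\<close> in \<open>(0, 1)\<close> the outer roots are distinct and the arguments of all the
  logarithms and square roots avoid the nonpositive real axis.\<close>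

lemma analytic_on_coeff_passage_poly:
  assumes "N \<ge> 1" "c > 0" "0 < z" "z < 1"
  shows "(\<lambda>z. coeff (passage_poly N c \<beta> z) n) analytic_on {complex_of_real z}"
proof -
  define r where "r = root (2 * N) ((1 / z - 1) / c)"
  have r: "radius N c (of_real z) = of_real r" "r > 0"
    using radius_of_real[OF assms] assms by (simp_all add: r_def)
  have pos: "(1 / of_real z - 1) / of_real c \<notin> (\<real>\<^sub>\<le>\<^sub>0 :: complex set)"
  proof -
    have "(1 / of_real z - 1) / of_real c = complex_of_real ((1 / z - 1) / c)" by simp
    moreover have "(1 / z - 1) / c > 0" using assms by simp
    ultimately show ?thesis by (simp only: nonpos_Reals_of_real_iff)
  qed
  have rad: "radius N c analytic_on {of_real z}"
    unfolding radius_def using pos assms by (intro analytic_intros) auto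
  have root: "(\<lambda>z. outer_root N (radius N c z) j) analytic_on {of_real z}" if "j \<in> {1..N}" for j
    unfolding outer_root_def exp_arsinh_def
    using r Re_phi_pos[OF that]
    by (intro analytic_intros rad) (auto intro!: one_plus_square_notin_nonpos_Reals)
  show ?thesis
    unfolding passage_poly_def
  proof (rule analytic_on_coeff_lagrange_poly)
    show "inj_on (outer_root N (radius N c w)) {1..N}" if "w \<in> {complex_of_real z}" for w
      using that r inj_on_outer_root by simp
    show "(\<lambda>z. outer_root N (radius N c z) j powi (- \<beta>)) analytic_on {of_real z}" if "j \<in> {1..N}" for j
      using norm_outer_root_gt_1[OF r(2) that] r(1) by (intro analytic_intros root that) auto
  qed (rule root)
qed

lemma poly_eq_sum_coeff_lessThan:
  fixes p :: "'a::comm_ring_1 poly"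
  assumes "degree p < n"
  shows "poly p x = (\<Sum>i<n. coeff p i * x ^ i)"
  unfolding poly_altdef
  by (rule sum.mono_neutral_left) (use assms in \<open>auto simp: coeff_eq_0\<close>)

lemma sum_int_interval:
  "(\<Sum>l\<in>{\<beta>..\<beta> + int N - 1}. f l) = (\<Sum>i<N. f (\<beta> + int i))"
  by (rule sum.reindex_bij_witness[of _ "\<lambda>i. \<beta> + int i" "\<lambda>l. nat (l - \<beta>)"]) auto

text \<open>The passage polynomial and \<open>\<Sum>i<N. monom (H_series N c \<beta> (\<beta> + i) z) i\<close> both have degree
  below \<open>N\<close>, and by optional stopping they agree at the \<open>N\<close> distinct outer roots.\<close>

lemma coeff_passage_poly_eq_H_series:
  assumes "N \<ge> 1" "c > 0" "\<beta> \<ge> 1" "0 < z" "z < 1" "z < 1 / total_weight N c" "i < N"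
  shows "coeff (passage_poly N c \<beta> (of_real z)) i = of_real (H_series N c \<beta> (\<beta> + int i) z)"
proof -
  define r where "r = root (2 * N) ((1 / z - 1) / c)"
  have r: "radius N c (of_real z) = of_real r" "r > 0" "c * r ^ (2 * N) = 1 / z - 1"
    using radius_of_real[OF assms(1,2,4,5)] assms by (simp_all add: r_def)
  let ?x = "outer_root N (of_real r)"
  define R where "R = (\<Sum>i<N. monom (complex_of_real (H_series N c \<beta> (\<beta> + int i) z)) i)"
  have R: "poly R (?x j) = ?x j powi (- \<beta>)" if j: "j \<in> {1..N}" for j
  proof -
    have x: "norm (?x j) > 1" "?x j \<noteq> 0" using norm_outer_root_gt_1[OF r(2) j] by auto
    have "1 + complex_of_real (c * r ^ (2 * N)) = of_real (1 / z)" unfolding r(3) by simp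
    then have "of_real z * step_gf N c (?x j) = 1"
      using step_gf_outer_root[OF assms(1) r(2) j, of c] assms(4) by simp
    from H_series_optional_stopping[OF assms(1-4,6) _ this]
    have "(\<Sum>i<N. of_real (H_series N c \<beta> (\<beta> + int i) z) * ?x j powi (\<beta> + int i)) = 1"
      using x by (simp add: sum_int_interval)
    then have "?x j powi \<beta> * poly R (?x j) = 1"
      using x by (simp add: R_def poly_sum poly_monom sum_distrib_left power_int_add mult_ac)
    then show ?thesis
      using x by (simp add: power_int_minus field_simps)
  qed
  have "passage_poly N c \<beta> (of_real z) = R"
  proof (rule poly_eqI_degree)
    show "poly (passage_poly N c \<beta> (of_real z)) x = poly R x" if "x \<in> ?x ` {1..N}" for x
      using that inj_on_outer_root[OF r(2)] R by (auto simp: passage_poly_def r(1) poly_lagrange_poly_node)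
    have card: "card (?x ` {1..N}) = N"
      using inj_on_outer_root[OF r(2)] by (simp add: card_image)
    show "degree (passage_poly N c \<beta> (of_real z)) < card (?x ` {1..N})"
      unfolding card passage_poly_def using degree_lagrange_poly[of "{1..N}"] assms(1) by simp
    show "degree R < card (?x ` {1..N})"
      unfolding card R_def using assms(1)
      by (intro degree_sum_less) (auto intro: le_less_trans[OF degree_monom_le])
  qed
  then show ?thesis using assms(7) by (simp add: R_def coeff_sum if_distrib cong: if_cong)
qed

text \<open>The real part of the coefficient continues the power series, and continuations are unique. The
  imaginary part vanishes for small \<open>z\<close>, hence on all of \<open>(0, 1)\<close> by the same uniqueness.\<close>

lemma H_plus_eq_coeff_passage_poly:
  assumes "N \<ge> 1" "c > 0" "\<beta> \<ge> 1" "0 < z" "z < 1" "i < N"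
  shows "complex_of_real (H_plus N c \<beta> (\<beta> + int i) z) = coeff (passage_poly N c \<beta> (of_real z)) i"
proof -
  let ?l = "\<beta> + int i"
  define g where "g = (\<lambda>z. coeff (passage_poly N c \<beta> z) i)"
  have g: "g analytic_on {complex_of_real x}" if "x \<in> {0<..<1}" for x
    unfolding g_def using analytic_on_coeff_passage_poly assms(1,2) that by auto
  have cont: "H_continuation N c \<beta> ?l (\<lambda>z. Re (g (of_real z)))"
    unfolding H_continuation_def
    using analytic_imp_Re_real_analytic_on[of "{0<..<1}" g] g
      coeff_passage_poly_eq_H_series[OF assms(1-3) _ _ _ assms(6)]
    by (auto simp: g_def)
  then have "H_continuation N c \<beta> ?l (H_plus N c \<beta> ?l)"
    unfolding H_plus_def by (rule someI[where P = "H_continuation N c \<beta> ?l"])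
  from H_continuation_unique[OF assms(1,2) this cont]
  have Re: "H_plus N c \<beta> ?l z = Re (g (of_real z))" using assms by simp
  \<comment> \<open>the imaginary part of \<open>g\<close>, written as a real part so that real-analyticity applies\<close>
  have "Re (- \<i> * g (of_real z)) = 0"
  proof (rule real_analytic_on_unique[where f = "\<lambda>x. Re (- \<i> * g (of_real x))" and g = "\<lambda>_. 0" and a = 0 and b = 1
        and d = "min 1 (1 / total_weight N c)"])
    show "(\<lambda>z. Re (- \<i> * g (of_real z))) real_analytic_on {0<..<1}"
      by (rule analytic_imp_Re_real_analytic_on) (auto intro!: analytic_intros g)
    show "(\<lambda>_. 0) real_analytic_on {0<..<1}"
      using analytic_imp_Re_real_analytic_on[of "{0<..<1}" "\<lambda>_. 0"] by simp
    show "Re (- \<i> * g (of_real x)) = 0" if "0 < x" "x < min 1 (1 / total_weight N c)" for x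
      using coeff_passage_poly_eq_H_series[OF assms(1-3) _ _ _ assms(6), of x] that by (simp add: g_def)
  qed (use assms total_weight_pos in auto)
  with Re show ?thesis by (simp add: g_def complex_eq_iff)
qed

text \<open>The transform is \<open>x powi \<beta>\<close> times the passage polynomial, at the point \<open>x = exp (\<i> * \<mu> * \<epsilon>)\<close>
  of the unit circle and with \<open>\<beta> = level b \<epsilon>\<close>. This turns the sum over landing places into an
  evaluation of a Lagrange interpolation formula.\<close>

lemma scaled_transform_eq_poly:
  assumes "N \<ge> 1" "c > 0" "b > 0" "\<epsilon> > 0" "lam > 0"
  shows "scaled_transform N c b \<epsilon> lam \<mu> =
    exp (\<i> * of_real (\<mu> * (\<epsilon> * real_of_int (level b \<epsilon>)))) *
    poly (passage_poly N c (level b \<epsilon>) (of_real (exp (- lam * \<epsilon> ^ (2 * N))))) (exp (\<i> * of_real (\<mu> * \<epsilon>)))"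
proof -
  let ?z = "exp (- lam * \<epsilon> ^ (2 * N))" and ?b = "level b \<epsilon>"
  let ?p = "passage_poly N c ?b (of_real ?z)"
  have z: "0 < ?z" "?z < 1" using assms by simp_all
  have b: "?b \<ge> 1" using level_pos assms by blast
  have deg: "degree ?p < N"
    using degree_lagrange_poly[of "{1..N}"] assms(1) by (simp add: passage_poly_def)
  have "scaled_transform N c b \<epsilon> lam \<mu> =
      (\<Sum>i<N. exp (\<i> * of_real (\<mu> * \<epsilon> * real_of_int (?b + int i))) * coeff ?p i)"
    unfolding scaled_transform_def sum_int_interval
    by (intro sum.cong refl) (simp only: H_plus_eq_coeff_passage_poly[OF assms(1,2) b z] lessThan_iff)
  also have "\<dots> = (\<Sum>i<N. exp (\<i> * of_real (\<mu> * (\<epsilon> * real_of_int ?b))) *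
      (coeff ?p i * exp (\<i> * of_real (\<mu> * \<epsilon>)) ^ i))"
    by (intro sum.cong refl) (simp add: algebra_simps exp_add flip: exp_of_nat_mult)
  finally show ?thesis
    unfolding poly_eq_sum_coeff_lessThan[OF deg] sum_distrib_left .
qed

section \<open>The scaling limit\<close>

lemma tendsto_level:
  "((\<lambda>\<epsilon>. \<epsilon> * real_of_int (level b \<epsilon>)) \<longlongrightarrow> b) (at_right 0)"
proof (rule tendsto_sandwich)
  have pos: "\<forall>\<^sub>F \<epsilon> in at_right 0. \<epsilon> > (0::real)" by (simp add: eventually_at_right_less)
  then show "\<forall>\<^sub>F \<epsilon> in at_right 0. b \<le> \<epsilon> * real_of_int (level b \<epsilon>)"
    by eventually_elim (simp add: level_le_iff)
  from pos show "\<forall>\<^sub>F \<epsilon> in at_right 0. \<epsilon> * real_of_int (level b \<epsilon>) \<le> b + \<epsilon>"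
  proof eventually_elim
    fix \<epsilon> :: real assume e: "\<epsilon> > 0"
    have "real_of_int (level b \<epsilon>) \<le> b / \<epsilon> + 1" unfolding level_def by linarith
    then have "\<epsilon> * real_of_int (level b \<epsilon>) \<le> \<epsilon> * (b / \<epsilon> + 1)" using e by (intro mult_left_mono) auto
    then show "\<epsilon> * real_of_int (level b \<epsilon>) \<le> b + \<epsilon>" using e by (simp add: distrib_left)
  qed
  have "((\<lambda>\<epsilon>. b + \<epsilon>) \<longlongrightarrow> b + 0) (at_right 0)" by (intro tendsto_intros)
  then show "((\<lambda>\<epsilon>. b + \<epsilon>) \<longlongrightarrow> b) (at_right 0)" by simp
qed simp

lemma tendsto_exp_quotient:
  fixes a :: "'a :: {real_normed_field, banach}"
  shows "((\<lambda>h. (exp (a * h) - 1) / h) \<longlongrightarrow> a) (at 0)"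
proof -
  have "((\<lambda>h. exp (a * h)) has_field_derivative a) (at 0)"
    by (auto intro!: derivative_eq_intros)
  then show ?thesis by (simp add: has_field_derivative_iff)
qed

lemma tendsto_Ln_quotient: "((\<lambda>x. Ln x / (x - 1)) \<longlongrightarrow> 1) (at 1)"
proof -
  have "(Ln has_field_derivative inverse 1) (at 1)"
    by (intro has_field_derivative_Ln) auto
  then show ?thesis by (simp add: has_field_derivative_iff)
qed

definition scaled_radius :: "nat \<Rightarrow> real \<Rightarrow> real \<Rightarrow> real \<Rightarrow> real" where
  "scaled_radius N c lam \<epsilon> = root (2 * N) ((1 / exp (- lam * \<epsilon> ^ (2 * N)) - 1) / c)"

lemma scaled_radius_pos:
  assumes "N \<ge> 1" "c > 0" "lam > 0" "\<epsilon> > 0"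
  shows "scaled_radius N c lam \<epsilon> > 0"
  using assms by (simp add: scaled_radius_def)

lemma tendsto_scaled_radius:
  assumes "N \<ge> 1" "c > 0"
  shows "((\<lambda>\<epsilon>. scaled_radius N c lam \<epsilon> / \<epsilon>) \<longlongrightarrow> root (2 * N) (lam / c)) (at_right 0)"
proof -
  have pos: "\<forall>\<^sub>F \<epsilon> in at_right 0. \<epsilon> > (0::real)" by (simp add: eventually_at_right_less)
  have "((\<lambda>\<epsilon>. \<epsilon> ^ (2 * N)) \<longlongrightarrow> 0 ^ (2 * N)) (at_right (0::real))" by (intro tendsto_intros)
  then have "filterlim (\<lambda>\<epsilon>::real. \<epsilon> ^ (2 * N)) (at 0) (at_right 0)"
    using assms(1) eventually_mono[OF pos] by (auto simp: filterlim_at power_0_left)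
  from filterlim_compose[OF tendsto_exp_quotient this]
  have "((\<lambda>\<epsilon>. root (2 * N) ((exp (lam * \<epsilon> ^ (2 * N)) - 1) / \<epsilon> ^ (2 * N) / c))
      \<longlongrightarrow> root (2 * N) (lam / c)) (at_right 0)"
    using assms(2) by (intro tendsto_intros) auto
  moreover have "\<forall>\<^sub>F \<epsilon> in at_right 0.
      root (2 * N) ((exp (lam * \<epsilon> ^ (2 * N)) - 1) / \<epsilon> ^ (2 * N) / c) = scaled_radius N c lam \<epsilon> / \<epsilon>"
    using pos
  proof eventually_elim
    fix \<epsilon> :: real assume "\<epsilon> > 0"
    then have "\<epsilon> = root (2 * N) (\<epsilon> ^ (2 * N))"
      using assms(1) by (simp add: real_root_power_cancel)
    then have "scaled_radius N c lam \<epsilon> / \<epsilon>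
        = root (2 * N) ((exp (lam * \<epsilon> ^ (2 * N)) - 1) / c) / root (2 * N) (\<epsilon> ^ (2 * N))"
      by (simp add: scaled_radius_def exp_minus inverse_eq_divide)
    then show "root (2 * N) ((exp (lam * \<epsilon> ^ (2 * N)) - 1) / \<epsilon> ^ (2 * N) / c) = scaled_radius N c lam \<epsilon> / \<epsilon>"
      by (simp only: real_root_divide[symmetric] divide_divide_eq_left mult.commute)
  qed
  ultimately show ?thesis by (rule Lim_transform_eventually)
qed

text \<open>The identity \<open>A\<^sup>2 - 1 = 2 * w * A\<close> reduces the first-order behaviour of the root to that of
  \<open>scaled_radius\<close>, since \<open>A\<close> tends to \<open>1\<close>.\<close>

lemma tendsto_outer_root_quotient:
  assumes "N \<ge> 1" "c > 0"
  shows "((\<lambda>\<epsilon>. (outer_root N (of_real (scaled_radius N c lam \<epsilon>)) j - 1) / of_real \<epsilon>)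
    \<longlongrightarrow> of_real (root (2 * N) (lam / c)) * phi N j) (at_right 0)"
proof -
  let ?\<rho> = "root (2 * N) (lam / c)" and ?r = "\<lambda>\<epsilon>. scaled_radius N c lam \<epsilon>"
  let ?w = "\<lambda>\<epsilon>. complex_of_real (?r \<epsilon> / \<epsilon> * \<epsilon>) * phi N j / 2"
  have pos: "\<forall>\<^sub>F \<epsilon> in at_right 0. \<epsilon> > (0::real)" by (simp add: eventually_at_right_less)
  have rho: "((\<lambda>\<epsilon>. complex_of_real (?r \<epsilon> / \<epsilon>)) \<longlongrightarrow> of_real ?\<rho>) (at_right 0)"
    using tendsto_scaled_radius[OF assms] by (intro tendsto_intros)
  have "(?w \<longlongrightarrow> complex_of_real (?\<rho> * 0) * phi N j / 2) (at_right 0)"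
    using tendsto_scaled_radius[OF assms] by (intro tendsto_intros) auto
  then have "(?w \<longlongrightarrow> 0) (at_right 0)" by simp
  moreover have "isCont exp_arsinh 0"
    unfolding exp_arsinh_def by (intro continuous_intros isCont_o2[OF _ continuous_at_csqrt]) auto
  ultimately have "((\<lambda>\<epsilon>. exp_arsinh (?w \<epsilon>)) \<longlongrightarrow> exp_arsinh 0) (at_right 0)"
    by (rule isCont_tendsto_compose[rotated])
  then have "((\<lambda>\<epsilon>. complex_of_real (?r \<epsilon> / \<epsilon>) * phi N j * exp_arsinh (?w \<epsilon>))
      \<longlongrightarrow> of_real ?\<rho> * phi N j * exp_arsinh 0) (at_right 0)"
    by (intro tendsto_mult rho tendsto_const)
  moreover have "\<forall>\<^sub>F \<epsilon> in at_right 0. complex_of_real (?r \<epsilon> / \<epsilon>) * phi N j * exp_arsinh (?w \<epsilon>)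
      = (outer_root N (of_real (?r \<epsilon>)) j - 1) / of_real \<epsilon>"
    using pos by eventually_elim (simp add: outer_root_diff_1)
  ultimately have "((\<lambda>\<epsilon>. (outer_root N (of_real (?r \<epsilon>)) j - 1) / of_real \<epsilon>)
      \<longlongrightarrow> of_real ?\<rho> * phi N j * exp_arsinh 0) (at_right 0)"
    by (rule Lim_transform_eventually)
  then show ?thesis by (simp add: exp_arsinh_def)
qed

text \<open>A root \<open>x = 1 + \<delta>\<close> with \<open>\<delta> / \<epsilon>\<close> convergent is raised to a power of order \<open>1 / \<epsilon>\<close>, so the limit is
  an exponential. The exponent splits into three convergent factors,
  \<open>\<epsilon> * level b \<epsilon>\<close>, \<open>\<delta> / \<epsilon>\<close> and \<open>Ln x / (x - 1)\<close>.\<close>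

lemma tendsto_outer_root_power_level:
  assumes "N \<ge> 1" "c > 0" "lam > 0" "j \<in> {1..N}"
  shows "((\<lambda>\<epsilon>. outer_root N (of_real (scaled_radius N c lam \<epsilon>)) j powi (- level b \<epsilon>))
    \<longlongrightarrow> exp (- phi N j * of_real (root (2 * N) (lam / c) * b))) (at_right 0)"
proof -
  let ?\<rho> = "root (2 * N) (lam / c)"
  let ?x = "\<lambda>\<epsilon>. outer_root N (of_real (scaled_radius N c lam \<epsilon>)) j"
  have pos: "\<forall>\<^sub>F \<epsilon> in at_right 0. \<epsilon> > (0::real)" by (simp add: eventually_at_right_less)
  note q = tendsto_outer_root_quotient[OF assms(1,2), of lam j]
  have ne: "\<forall>\<^sub>F \<epsilon> in at_right 0. ?x \<epsilon> \<noteq> 1 \<and> ?x \<epsilon> \<noteq> 0"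
    using pos
  proof eventually_elim
    fix \<epsilon> :: real assume "\<epsilon> > 0"
    then show "?x \<epsilon> \<noteq> 1 \<and> ?x \<epsilon> \<noteq> 0"
      using norm_outer_root_gt_1[OF scaled_radius_pos[OF assms(1-3)] assms(4), of \<epsilon>] by auto
  qed
  have "((\<lambda>\<epsilon>. (?x \<epsilon> - 1) / of_real \<epsilon> * of_real \<epsilon> + 1) \<longlongrightarrow> of_real ?\<rho> * phi N j * of_real 0 + 1) (at_right 0)"
    by (intro tendsto_intros q)
  moreover have "\<forall>\<^sub>F \<epsilon> in at_right 0. (?x \<epsilon> - 1) / of_real \<epsilon> * of_real \<epsilon> + 1 = ?x \<epsilon>"
    using pos by eventually_elim simp
  ultimately have "(?x \<longlongrightarrow> of_real ?\<rho> * phi N j * of_real 0 + 1) (at_right 0)"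
    by (rule Lim_transform_eventually)
  then have "filterlim ?x (at 1) (at_right 0)"
    using ne by (auto simp: filterlim_at elim: eventually_mono)
  from filterlim_compose[OF tendsto_Ln_quotient this]
  have "((\<lambda>\<epsilon>. exp (- (complex_of_real (\<epsilon> * real_of_int (level b \<epsilon>)) *
        ((?x \<epsilon> - 1) / of_real \<epsilon>) * (Ln (?x \<epsilon>) / (?x \<epsilon> - 1)))))
      \<longlongrightarrow> exp (- (complex_of_real b * (of_real ?\<rho> * phi N j) * 1))) (at_right 0)"
    by (intro tendsto_intros q tendsto_level)
  moreover have "\<forall>\<^sub>F \<epsilon> in at_right 0. exp (- (complex_of_real (\<epsilon> * real_of_int (level b \<epsilon>)) *
        ((?x \<epsilon> - 1) / of_real \<epsilon>) * (Ln (?x \<epsilon>) / (?x \<epsilon> - 1)))) = ?x \<epsilon> powi (- level b \<epsilon>)"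
    using pos ne
  proof eventually_elim
    fix \<epsilon> :: real assume *: "\<epsilon> > 0" "?x \<epsilon> \<noteq> 1 \<and> ?x \<epsilon> \<noteq> 0"
    then have "complex_of_real (\<epsilon> * real_of_int (level b \<epsilon>)) *
        ((?x \<epsilon> - 1) / of_real \<epsilon>) * (Ln (?x \<epsilon>) / (?x \<epsilon> - 1)) = of_int (level b \<epsilon>) * Ln (?x \<epsilon>)"
      by simp
    moreover have "?x \<epsilon> powi (- level b \<epsilon>) = exp (of_int (- level b \<epsilon>) * Ln (?x \<epsilon>))"
      using * complex_powr_of_int[of "?x \<epsilon>" "- level b \<epsilon>"] by (simp add: powr_def)
    ultimately show "exp (- (complex_of_real (\<epsilon> * real_of_int (level b \<epsilon>)) *
        ((?x \<epsilon> - 1) / of_real \<epsilon>) * (Ln (?x \<epsilon>) / (?x \<epsilon> - 1)))) = ?x \<epsilon> powi (- level b \<epsilon>)"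
      by simp
  qed
  ultimately have "((\<lambda>\<epsilon>. ?x \<epsilon> powi (- level b \<epsilon>))
      \<longlongrightarrow> exp (- (complex_of_real b * (of_real ?\<rho> * phi N j) * 1))) (at_right 0)"
    by (rule Lim_transform_eventually)
  then show ?thesis by (simp add: mult_ac)
qed

text \<open>Since \<open>cnj (phi N j)\<close> is the inverse of \<open>phi N j\<close>, this is the limiting Lagrange factor with
  \<open>\<rho> * phi N j\<close> taken out of the numerator.\<close>

lemma lagrange_factor_limit:
  assumes "\<rho> > 0" "j \<in> {1..N}" "k \<in> {1..N}" "j \<noteq> k"
  shows "(\<i> * of_real \<mu> - of_real \<rho> * phi N j) / (of_real \<rho> * phi N k - of_real \<rho> * phi N j)
    = phi N j / (phi N j - phi N k) * (1 - \<i> * cnj (phi N j) * of_real \<mu> / of_real \<rho>)"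
proof -
  have 1: "phi N j * cnj (phi N j) = 1"
    by (simp add: complex_norm_square[symmetric] norm_phi)
  have ne: "phi N j - phi N k \<noteq> 0"
    using inj_onD[OF inj_on_phi _ assms(2,3)] assms(4) by auto
  have "phi N j * (1 - \<i> * cnj (phi N j) * of_real \<mu> / of_real \<rho>)
      = phi N j - \<i> * (phi N j * cnj (phi N j)) * of_real \<mu> / of_real \<rho>"
    by (simp add: algebra_simps)
  also have "\<dots> = - (\<i> * of_real \<mu> - of_real \<rho> * phi N j) / of_real \<rho>"
    unfolding 1 using assms(1) by (simp add: field_simps)
  finally have "phi N j / (phi N j - phi N k) * (1 - \<i> * cnj (phi N j) * of_real \<mu> / of_real \<rho>)
      = - (\<i> * of_real \<mu> - of_real \<rho> * phi N j) / (of_real \<rho> * (phi N j - phi N k))"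
    by simp
  also have "of_real \<rho> * (phi N j - phi N k) = - (of_real \<rho> * phi N k - of_real \<rho> * phi N j)"
    by (simp add: algebra_simps)
  finally show ?thesis by (simp only: minus_divide_divide)
qed

text \<open>Each Lagrange factor \<open>(x - x\<^sub>j) / (x\<^sub>k - x\<^sub>j)\<close> is a quotient of differences of points at distance of
  order \<open>\<epsilon>\<close> from \<open>1\<close>; dividing numerator and denominator by \<open>\<epsilon>\<close> makes both converge.\<close>

lemma tendsto_scaled_transform:
  assumes "N \<ge> 1" "c > 0" "b > 0" "lam > 0"
  shows "((\<lambda>\<epsilon>. scaled_transform N c b \<epsilon> lam \<mu>) \<longlongrightarrow>
    exp (\<i> * of_real (\<mu> * b)) *
    (\<Sum>k=1..N.
      (\<Prod>j\<in>{1..N} - {k}. phi N j / (phi N j - phi N k)) *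
      (\<Prod>j\<in>{1..N} - {k}. 1 - \<i> * cnj (phi N j) * of_real \<mu> / of_real (root (2 * N) (lam / c))) *
      exp (- phi N k * of_real (root (2 * N) (lam / c) * b)))) (at_right 0)"
proof -
  let ?\<rho> = "root (2 * N) (lam / c)"
  let ?x = "\<lambda>\<epsilon>. outer_root N (of_real (scaled_radius N c lam \<epsilon>))"
  let ?d = "\<lambda>\<epsilon> j. (?x \<epsilon> j - 1) / of_real \<epsilon>"
  let ?e = "\<lambda>\<epsilon>. (exp (\<i> * of_real \<mu> * of_real \<epsilon>) - 1) / of_real \<epsilon>"
  have rho: "?\<rho> > 0" using assms by simp
  have pos: "\<forall>\<^sub>F \<epsilon> in at_right 0. \<epsilon> > (0::real)" by (simp add: eventually_at_right_less)
  have "((\<lambda>\<epsilon>. complex_of_real \<epsilon>) \<longlongrightarrow> of_real 0) (at_right 0)" by (intro tendsto_intros)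
  then have "filterlim complex_of_real (at 0) (at_right 0)"
    using pos by (auto simp: filterlim_at elim: eventually_mono)
  from filterlim_compose[OF tendsto_exp_quotient this]
  have e: "(?e \<longlongrightarrow> \<i> * of_real \<mu>) (at_right 0)" .
  have "((\<lambda>\<epsilon>. exp (\<i> * of_real (\<mu> * (\<epsilon> * real_of_int (level b \<epsilon>)))) *
      (\<Sum>k=1..N. ?x \<epsilon> k powi (- level b \<epsilon>) *
        (\<Prod>j\<in>{1..N} - {k}. (?e \<epsilon> - ?d \<epsilon> j) / (?d \<epsilon> k - ?d \<epsilon> j))))
    \<longlongrightarrow> exp (\<i> * of_real (\<mu> * b)) *
      (\<Sum>k=1..N. exp (- phi N k * of_real (?\<rho> * b)) *
        (\<Prod>j\<in>{1..N} - {k}. (\<i> * of_real \<mu> - of_real ?\<rho> * phi N j)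
           / (of_real ?\<rho> * phi N k - of_real ?\<rho> * phi N j)))) (at_right 0)"
  proof (intro tendsto_intros tendsto_level e tendsto_outer_root_quotient
      tendsto_outer_root_power_level assms(1,2,4))
    fix k j assume "k \<in> {1..N}" "j \<in> {1..N} - {k}"
    then show "of_real ?\<rho> * phi N k - of_real ?\<rho> * phi N j \<noteq> 0"
      using inj_onD[OF inj_on_phi, of N k j] rho by auto
  qed
  also have "(\<Sum>k=1..N. exp (- phi N k * of_real (?\<rho> * b)) *
        (\<Prod>j\<in>{1..N} - {k}. (\<i> * of_real \<mu> - of_real ?\<rho> * phi N j)
           / (of_real ?\<rho> * phi N k - of_real ?\<rho> * phi N j)))
    = (\<Sum>k=1..N.
      (\<Prod>j\<in>{1..N} - {k}. phi N j / (phi N j - phi N k)) *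
      (\<Prod>j\<in>{1..N} - {k}. 1 - \<i> * cnj (phi N j) * of_real \<mu> / of_real ?\<rho>) *
      exp (- phi N k * of_real (?\<rho> * b)))"
  proof (rule sum.cong[OF refl], goal_cases)
    case (1 k)
    have "(\<Prod>j\<in>{1..N} - {k}. (\<i> * of_real \<mu> - of_real ?\<rho> * phi N j)
           / (of_real ?\<rho> * phi N k - of_real ?\<rho> * phi N j))
      = (\<Prod>j\<in>{1..N} - {k}. phi N j / (phi N j - phi N k) *
          (1 - \<i> * cnj (phi N j) * of_real \<mu> / of_real ?\<rho>))"
      using 1 by (intro prod.cong refl lagrange_factor_limit[OF rho]) auto
    then show ?case by (simp only: prod.distrib mult_ac)
  qed
  finally show ?thesis
  proof (rule Lim_transform_eventually)
    show "\<forall>\<^sub>F \<epsilon> in at_right 0. exp (\<i> * of_real (\<mu> * (\<epsilon> * real_of_int (level b \<epsilon>)))) *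
      (\<Sum>k=1..N. ?x \<epsilon> k powi (- level b \<epsilon>) *
        (\<Prod>j\<in>{1..N} - {k}. (?e \<epsilon> - ?d \<epsilon> j) / (?d \<epsilon> k - ?d \<epsilon> j)))
      = scaled_transform N c b \<epsilon> lam \<mu>"
      using pos
    proof eventually_elim
      fix \<epsilon> :: real assume eps: "\<epsilon> > 0"
      let ?z = "exp (- lam * \<epsilon> ^ (2 * N))"
      have "radius N c (of_real ?z) = of_real (scaled_radius N c lam \<epsilon>)"
        unfolding scaled_radius_def using assms eps by (intro radius_of_real) auto
      moreover have "(?e \<epsilon> - ?d \<epsilon> j) / (?d \<epsilon> k - ?d \<epsilon> j)
          = (exp (\<i> * of_real (\<mu> * \<epsilon>)) - ?x \<epsilon> j) / (?x \<epsilon> k - ?x \<epsilon> j)" for j k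
        using eps by (simp add: diff_divide_distrib[symmetric] mult.assoc)
      ultimately show "exp (\<i> * of_real (\<mu> * (\<epsilon> * real_of_int (level b \<epsilon>)))) *
          (\<Sum>k=1..N. ?x \<epsilon> k powi (- level b \<epsilon>) *
            (\<Prod>j\<in>{1..N} - {k}. (?e \<epsilon> - ?d \<epsilon> j) / (?d \<epsilon> k - ?d \<epsilon> j)))
          = scaled_transform N c b \<epsilon> lam \<mu>"
        unfolding scaled_transform_eq_poly[OF assms(1-3) eps assms(4)] passage_poly_def poly_lagrange_poly
        by simp
    qed
  qed
qed

theorem theorem7p2:
  fixes N :: nat and c b :: real
  assumes "N \<ge> 1" and "0 < c" and "c \<le> 1 / 2 ^ (2 * N - 1)" and "b > 0"
  shows "\<forall>lam>0. \<forall>\<mu>::real.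
     ((\<lambda>\<epsilon>. scaled_transform N c b \<epsilon> lam \<mu>) \<longlongrightarrow> limit_transform N c b lam \<mu>) (at_right 0) \<and>
     limit_transform N c b lam \<mu> =
       exp (\<i> * complex_of_real (\<mu> * b)) *
       (\<Sum>k=1..N.
          (\<Prod>j\<in>{1..N} - {k}. phi N j / (phi N j - phi N k)) *
          (\<Prod>j\<in>{1..N} - {k}.
             1 - \<i> * cnj (phi N j) * complex_of_real \<mu> / complex_of_real (root (2 * N) (lam / c))) *
          exp (- phi N k * complex_of_real (root (2 * N) (lam / c) * b)))"
proof (intro allI impI)
  fix lam \<mu> :: real assume "lam > 0"
  note lim = tendsto_scaled_transform[OF assms(1,2,4) this, of \<mu>]
  then have "limit_transform N c b lam \<mu> = exp (\<i> * complex_of_real (\<mu> * b)) *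
       (\<Sum>k=1..N.
          (\<Prod>j\<in>{1..N} - {k}. phi N j / (phi N j - phi N k)) *
          (\<Prod>j\<in>{1..N} - {k}.
             1 - \<i> * cnj (phi N j) * complex_of_real \<mu> / complex_of_real (root (2 * N) (lam / c))) *
          exp (- phi N k * complex_of_real (root (2 * N) (lam / c) * b)))" (is "_ = ?rhs")
    unfolding limit_transform_def by (intro tendsto_Lim) simp_all
  with lim show "((\<lambda>\<epsilon>. scaled_transform N c b \<epsilon> lam \<mu>) \<longlongrightarrow> limit_transform N c b lam \<mu>) (at_right 0) \<and>
      limit_transform N c b lam \<mu> = ?rhs"
    by simp
qed

end
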